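(* Let $k,l$ be fixed integers and let $n\to\infty$. (1) If $l\ge 3$ and $k\ge 2$, then $ex(n,C_{2l},C_{2k})\le (1+o(1))\frac{2^{l-2}(k-1)^l}{2l}n^l$. (2) If $k>l\ge 2$, then $ex(n,C_{2l},C_{2k})\ge (1+o(1))\frac{(k-1)_l}{2l}n^l$. (3) If $l>k\ge 3$, then $ex(n,C_{2l},C_{2k})\ge (1+o(1))\frac{1}{l^l}n^l$.
   Context: $C_k$ denotes the cycle with $k$ vertices. For a graph $H$ and a family of graphs $\mathcal F$ (or a single graph $F$), $ex(n,H,\mathcal F)$ is the maximum number of (not necessarily induced) subgraphs isomorphic to $H$ in an $n$-vertex graph containing no member of $\mathcal F$ as a subgraph. For positive integers $n,l$, $(n)_l=n(n-1)\cdots(n-l+1)$. *)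

theory Defs
  imports Complex_Main
begin

definition simple_graph :: "nat \<Rightarrow> nat set set \<Rightarrow> bool" where
  "simple_graph n E \<longleftrightarrow> E \<subseteq> {e. \<exists>u v. e = {u, v} \<and> u \<noteq> v \<and> u < n \<and> v < n}"

definition cycle_edges :: "(nat \<Rightarrow> 'a) \<Rightarrow> nat \<Rightarrow> 'a set set" where
  "cycle_edges f m = (\<lambda>i. {f i, f (Suc i mod m)}) ` {..<m}"

(* the subgraphs of E isomorphic to C_m (a cycle subgraph is determined by its edge set) *)
definition cycle_copies :: "nat \<Rightarrow> 'a set set \<Rightarrow> 'a set set set" where
  "cycle_copies m E = {C. C \<subseteq> E \<and> (\<exists>f. inj_on f {..<m} \<and> C = cycle_edges f m)}"

definition ex_cyc :: "nat \<Rightarrow> nat \<Rightarrow> nat \<Rightarrow> nat" where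
  "ex_cyc n l k = Max {card (cycle_copies (2*l) E) | E. simple_graph n E \<and> cycle_copies (2*k) E = {}}"

end

theory Submission
  imports Defs "HOL-Library.FuncSet"
begin

text \<open>Upper bound. Let G be a C_2k-free graph on n vertices. Write a 2l-cycle as a closed walk
  a_1, ..., a_l on one of its parity classes; the number of cycles with this class is at most the
  product of the codegrees of consecutive a_i, and by AM-GM the sum of these products is at most
  R^(l-2) S, where R bounds the row sums and S is the sum of the squared codegrees. A neighbourhood
  N(v) is joined to the rest of the graph without long paths, so Erdos-Gallai gives row sum at most
  (k-1) n + 2k deg(v). Hence for every \<open>\<delta> > 0\<close> only boundedly many vertices are heavy (of degree
  more than \<open>\<delta> n\<close>), and cycles with heavy vertices in both parity classes are negligible; for all
  others R is about (k-1) n. Call a pair fat if its codegree is at least 2k. Fat pairs inside N(b)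
  contain no path on k vertices, which bounds by Erdos-Gallai the quadrilaterals with a fat diagonal,
  and there are only O(e(G)) quadrilaterals with two thin diagonals. This gives S at most about
  (2k-3)(k-1) n^2, which is less than 2 (k-1)^2 n^2.

  Lower bounds. For l < k take the complete bipartite graph with parts of sizes k-1 and n-k+1; for
  l > k take a 2l-cycle and blow up every second vertex to about n/l copies.\<close>

subsection \<open>Counting by fibres\<close>

lemma card_eq_sum_card_fibres:
  assumes "finite A" "finite B" "f ` A \<subseteq> B"
  shows "card A = (\<Sum>b\<in>B. card {a \<in> A. f a = b})"
  using sum.group[OF assms, of "\<lambda>_. 1 :: nat"] by simp

lemma card_le_mult_card_if_fibres_le:
  assumes "finite A" "finite B" "f ` A \<subseteq> B" and "\<And>b. b \<in> B \<Longrightarrow> card {a \<in> A. f a = b} \<le> c"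
  shows "card A \<le> c * card B"
  using sum_bounded_above[of B "\<lambda>b. card {a \<in> A. f a = b}" c] assms(4)
  by (simp add: card_eq_sum_card_fibres[OF assms(1-3)] mult.commute)

lemma mult_card_le_card_if_fibres_ge:
  assumes "finite A" "finite B" "f ` A \<subseteq> B" and "\<And>b. b \<in> B \<Longrightarrow> c \<le> card {a \<in> A. f a = b}"
  shows "c * card B \<le> card A"
  using sum_bounded_below[of B c "\<lambda>b. card {a \<in> A. f a = b}"] assms(4)
  by (simp add: card_eq_sum_card_fibres[OF assms(1-3)] mult.commute)

subsection \<open>Paths in graphs with many edges\<close>

definition path_in :: "('a \<Rightarrow> 'a \<Rightarrow> bool) \<Rightarrow> 'a set \<Rightarrow> 'a list \<Rightarrow> bool" where
  "path_in R A xs \<longleftrightarrow> distinct xs \<and> set xs \<subseteq> A \<and> successively R xs"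

definition longest_path :: "('a \<Rightarrow> 'a \<Rightarrow> bool) \<Rightarrow> 'a set \<Rightarrow> 'a list \<Rightarrow> bool" where
  "longest_path R A xs \<longleftrightarrow> path_in R A xs \<and> (\<forall>ys. path_in R A ys \<longrightarrow> length ys \<le> length xs)"

definition arcs :: "('a \<Rightarrow> 'a \<Rightarrow> bool) \<Rightarrow> 'a set \<Rightarrow> ('a \<times> 'a) set" where
  "arcs R A = {(x, y). x \<in> A \<and> y \<in> A \<and> R x y}"

lemma path_in_Cons_iff:
  "path_in R A (x # xs) \<longleftrightarrow> x \<in> A \<and> x \<notin> set xs \<and> path_in R A xs \<and> (xs = [] \<or> R x (hd xs))"
  by (auto simp: path_in_def successively_Cons)

lemma path_in_append_iff:
  "path_in R A (xs @ ys) \<longleftrightarrow> path_in R A xs \<and> path_in R A ys \<and> set xs \<inter> set ys = {} \<and>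
     (xs = [] \<or> ys = [] \<or> R (last xs) (hd ys))"
  by (auto simp: path_in_def successively_append_iff)

lemma path_in_take: "path_in R A xs \<Longrightarrow> path_in R A (take i xs)"
  by (metis append_take_drop_id path_in_append_iff)

lemma path_in_drop: "path_in R A xs \<Longrightarrow> path_in R A (drop i xs)"
  by (metis append_take_drop_id path_in_append_iff)

lemma path_in_rev_iff [simp]:
  assumes "symp R"
  shows "path_in R A (rev xs) \<longleftrightarrow> path_in R A xs"
proof -
  have converse: "(\<lambda>x y. R y x) = R" using sympD[OF assms] by blast
  show ?thesis by (simp add: path_in_def converse cong del: successively_cong)
qed

lemma path_in_mono:
  assumes "path_in R A xs" "A \<subseteq> B" and "\<And>x y. x \<in> A \<Longrightarrow> y \<in> A \<Longrightarrow> R x y \<Longrightarrow> S x y"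
  shows "path_in S B xs"
proof -
  have "successively S xs"
    using assms(1) by (auto simp: path_in_def intro: successively_mono assms(3))
  then show ?thesis using assms(1,2) by (auto simp: path_in_def)
qed

lemma longest_path_rev: "symp R \<Longrightarrow> longest_path R A xs \<Longrightarrow> longest_path R A (rev xs)"
  by (simp add: longest_path_def)

lemma ex_longest_path:
  assumes "finite A"
  shows "\<exists>xs. longest_path R A xs"
proof -
  have "path_in R A []" by (simp add: path_in_def)
  moreover have "\<forall>xs. path_in R A xs \<longrightarrow> length xs < Suc (card A)"
    unfolding path_in_def by (metis assms card_mono distinct_card less_Suc_eq_le)
  ultimately show ?thesis
    unfolding longest_path_def using ex_has_greatest_nat[of "path_in R A" "[]" length] by blast
qed

lemma longest_path_nonempty:
  assumes "longest_path R A xs" "a \<in> A"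
  shows "xs \<noteq> []"
proof -
  have "path_in R A [a]" using assms(2) by (simp add: path_in_def)
  then show ?thesis using assms(1) unfolding longest_path_def by fastforce
qed

lemma neighbour_hd_longest_path:
  assumes "longest_path R A xs" "symp R" "xs \<noteq> []" "u \<in> A" "R (hd xs) u"
  shows "u \<in> set xs"
proof (rule ccontr)
  assume "u \<notin> set xs"
  then have "path_in R A (u # xs)"
    using assms by (simp add: path_in_Cons_iff longest_path_def sympD)
  then show False using assms(1) unfolding longest_path_def by fastforce
qed

lemma neighbour_last_longest_path:
  assumes "longest_path R A xs" "symp R" "xs \<noteq> []" "u \<in> A" "R (last xs) u"
  shows "u \<in> set xs"
  using neighbour_hd_longest_path[OF longest_path_rev[OF assms(2,1)] assms(2)] assms(3-5)
  by (simp add: hd_rev)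

lemma card_le_card_positions:
  assumes "{u \<in> A. P u} \<subseteq> set xs"
  shows "card {u \<in> A. P u} \<le> card {i. i < length xs \<and> P (xs ! i)}"
proof (rule surj_card_le)
  show "{u \<in> A. P u} \<subseteq> (!) xs ` {i. i < length xs \<and> P (xs ! i)}"
    using assms by (fastforce simp: in_set_conv_nth)
qed simp

lemma ex_crossing_neighbours:
  assumes "longest_path R A xs" "symp R" "irreflp R" "xs \<noteq> []"
    and degrees: "length xs \<le> card {u \<in> A. R (hd xs) u} + card {u \<in> A. R (last xs) u}"
  shows "\<exists>i. Suc i < length xs \<and> R (hd xs) (xs ! Suc i) \<and> R (last xs) (xs ! i)"
proof (rule ccontr)
  let ?I = "{i. Suc i < length xs \<and> R (hd xs) (xs ! Suc i)}"
  let ?J = "{i. i < length xs \<and> R (last xs) (xs ! i)}"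
  assume no_crossing: "\<not> ?thesis"
  have ends: "\<not> R (hd xs) (xs ! 0)" "\<not> R (last xs) (xs ! (length xs - 1))"
    using assms(3,4) by (simp_all add: hd_conv_nth last_conv_nth irreflpD)
  have "i \<in> {..<length xs - 1}" if "i \<in> ?J" for i
    using that ends(2) by (cases "i = length xs - 1") auto
  then have below: "?I \<union> ?J \<subseteq> {..<length xs - 1}" by auto
  have "{i. i < length xs \<and> R (hd xs) (xs ! i)} \<subseteq> Suc ` ?I"
  proof
    fix i assume "i \<in> {i. i < length xs \<and> R (hd xs) (xs ! i)}"
    then show "i \<in> Suc ` ?I" using ends(1) by (cases i) auto
  qed
  then have "card {i. i < length xs \<and> R (hd xs) (xs ! i)} \<le> card ?I"
    using finite_subset[OF below] by (intro surj_card_le) auto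
  moreover have "card {u \<in> A. R (hd xs) u} \<le> card {i. i < length xs \<and> R (hd xs) (xs ! i)}"
    using neighbour_hd_longest_path[OF assms(1,2,4)] by (intro card_le_card_positions) blast
  moreover have "card {u \<in> A. R (last xs) u} \<le> card ?J"
    using neighbour_last_longest_path[OF assms(1,2,4)] by (intro card_le_card_positions) blast
  moreover have "card ?I + card ?J = card (?I \<union> ?J)"
    using no_crossing finite_subset[OF below] by (intro card_Un_disjoint[symmetric]) auto
  moreover have "card (?I \<union> ?J) \<le> length xs - 1" using card_mono[OF _ below] by simp
  moreover have "length xs > 0" using assms(4) by simp
  ultimately show False using degrees by linarith
qed

lemma ex_closed_path_if_crossing_neighbours:
  assumes "path_in R A xs" "symp R" "Suc i < length xs"
    and "R (hd xs) (xs ! Suc i)" "R (last xs) (xs ! i)"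
  shows "\<exists>ys. path_in R A ys \<and> set ys = set xs \<and> length ys = length xs \<and> R (last ys) (hd ys)"
proof (intro exI conjI)
  let ?us = "take (Suc i) xs" and ?vs = "drop (Suc i) xs"
  let ?ys = "rev ?us @ ?vs"
  have nonempty: "?us \<noteq> []" "?vs \<noteq> []" using assms(3) by auto
  have hd_vs: "hd ?vs = xs ! Suc i" using assms(3) by (simp add: hd_drop_conv_nth)
  have last_us: "last ?us = xs ! i" using assms(3) nonempty(1) by (simp add: last_conv_nth)
  have "path_in R A ?us" "path_in R A ?vs" "set ?us \<inter> set ?vs = {}"
    using assms(1) path_in_append_iff[of R A ?us ?vs] by simp_all
  then show "path_in R A ?ys"
    using assms(2,4) nonempty hd_vs unfolding path_in_append_iff by (simp add: last_rev)
  show "set ?ys = set xs" by (metis append_take_drop_id set_append set_rev)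
  show "length ?ys = length xs" using assms(3) by simp
  show "R (last ?ys) (hd ?ys)"
    using assms(3,5) nonempty last_us by (simp add: hd_append hd_rev)
qed

lemma closed_longest_path_isolated:
  assumes "longest_path R A xs" "R (last xs) (hd xs)" "u \<in> set xs" "z \<in> A - set xs"
  shows "\<not> R z u"
proof
  assume "R z u"
  obtain us vs where xs: "xs = us @ u # vs" using split_list[OF assms(3)] by blast
  have "path_in R A (us @ u # vs)" using assms(1) by (simp add: longest_path_def xs)
  moreover have "R (last (u # vs)) (hd us)" if "us \<noteq> []" using assms(2) that by (simp add: xs)
  ultimately have "path_in R A ((u # vs) @ us)" unfolding path_in_append_iff by auto
  then have "path_in R A (z # (u # vs) @ us)"
    using assms(4) \<open>R z u\<close> xs unfolding path_in_Cons_iff[of _ _ z] by auto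
  then have "length (z # (u # vs) @ us) \<le> length xs" using assms(1) unfolding longest_path_def by blast
  then show False by (simp add: xs)
qed

lemma finite_arcs [simp]: "finite A \<Longrightarrow> finite (arcs R A)"
  by (rule finite_subset[of _ "A \<times> A"]) (auto simp: arcs_def)

lemma card_arcs_le_remove_vertex:
  assumes "finite A" "symp R"
  shows "card (arcs R A) \<le> card (arcs R (A - {z})) + 2 * card {u \<in> A. R z u}"
proof -
  let ?N = "{u \<in> A. R z u}"
  let ?at_z = "Pair z ` ?N \<union> (\<lambda>u. (u, z)) ` ?N"
  have "arcs R A \<subseteq> arcs R (A - {z}) \<union> ?at_z"
    using assms(2) by (auto simp: arcs_def dest: sympD)
  then have "card (arcs R A) \<le> card (arcs R (A - {z}) \<union> ?at_z)"
    using assms(1) by (intro card_mono) auto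
  also have "\<dots> \<le> card (arcs R (A - {z})) + (card (Pair z ` ?N) + card ((\<lambda>u. (u, z)) ` ?N))"
    by (meson add_left_mono card_Un_le order_trans)
  also have "\<dots> \<le> card (arcs R (A - {z})) + (card ?N + card ?N)"
    using assms(1) by (intro add_left_mono add_mono card_image_le) auto
  finally show ?thesis by simp
qed

lemma card_arcs_le_remove_component:
  assumes "finite A" "S \<subseteq> A" "symp R" and "\<And>z u. z \<in> A - S \<Longrightarrow> u \<in> S \<Longrightarrow> \<not> R z u"
  shows "card (arcs R A) \<le> card (arcs R (A - S)) + card (arcs R S)"
proof -
  have "arcs R A \<subseteq> arcs R (A - S) \<union> arcs R S"
    using assms(3,4) by (auto simp: arcs_def dest: sympD)
  then have "card (arcs R A) \<le> card (arcs R (A - S) \<union> arcs R S)"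
    using assms(1,2) by (intro card_mono) (auto dest: finite_subset)
  then show ?thesis using card_Un_le order_trans by blast
qed

lemma two_card_doubletons_le_card_arcs:
  assumes "finite A" "P \<subseteq> {{u, v} | u v. u \<in> A \<and> v \<in> A \<and> u \<noteq> v}"
  shows "2 * card P \<le> card (arcs (\<lambda>u v. u \<noteq> v \<and> {u, v} \<in> P) A)"
proof (rule mult_card_le_card_if_fibres_ge[of _ _ "\<lambda>(u, v). {u, v}"])
  let ?arcs = "arcs (\<lambda>u v. u \<noteq> v \<and> {u, v} \<in> P) A"
  show "finite ?arcs" using assms(1) by simp
  show "finite P" using assms by (auto intro: finite_subset[of _ "Pow A"])
  show "(\<lambda>(u, v). {u, v}) ` ?arcs \<subseteq> P" by (auto simp: arcs_def)
  fix e assume "e \<in> P"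
  then obtain u v where e: "e = {u, v}" "{u, v} \<in> P" "u \<in> A" "v \<in> A" "u \<noteq> v" using assms(2) by blast
  then have "{(u, v), (v, u)} \<subseteq> {a \<in> ?arcs. (\<lambda>(u, v). {u, v}) a = e}"
    by (auto simp: arcs_def insert_commute)
  then have "card {(u, v), (v, u)} \<le> card {a \<in> ?arcs. (\<lambda>(u, v). {u, v}) a = e}"
    using assms(1) by (intro card_mono) auto
  then show "2 \<le> card {a \<in> ?arcs. (\<lambda>(u, v). {u, v}) a = e}" using e(5) by simp
qed

lemma card_arcs_neq:
  assumes "finite S"
  shows "card (arcs (\<noteq>) S) = (card S - 1) * card S"
proof -
  have "arcs (\<noteq>) S = S \<times> S - (\<lambda>x. (x, x)) ` S" by (auto simp: arcs_def)
  then have "card (arcs (\<noteq>) S) = card S * card S - card S"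
    using assms by (simp add: card_Diff_subset image_subset_iff card_image inj_on_def card_cartesian_product)
  then show ?thesis by (simp add: diff_mult_distrib)
qed

lemma card_arcs_irrefl_le:
  assumes "finite S" "irreflp R"
  shows "card (arcs R S) \<le> (card S - 1) * card S"
proof -
  have "arcs R S \<subseteq> arcs (\<noteq>) S" using assms(2) by (auto simp: arcs_def irreflpD)
  then show ?thesis using assms(1) by (metis card_arcs_neq card_mono finite_arcs)
qed

lemma card_arcs_le_remove_longest_path:
  assumes "finite A" "longest_path R A xs" "symp R" "irreflp R" "xs \<noteq> []"
    and "length xs \<le> card {u \<in> A. R (hd xs) u} + card {u \<in> A. R (last xs) u}"
  shows "card (arcs R A) \<le> card (arcs R (A - set xs)) + (length xs - 1) * length xs"
proof -
  have path: "path_in R A xs" using assms(2) by (simp add: longest_path_def)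
  obtain ys where ys: "path_in R A ys" "set ys = set xs" "length ys = length xs" "R (last ys) (hd ys)"
    using ex_crossing_neighbours[OF assms(2-6)] ex_closed_path_if_crossing_neighbours[OF path assms(3)]
    by blast
  then have "longest_path R A ys" using assms(2) by (simp add: longest_path_def)
  then have "card (arcs R A) \<le> card (arcs R (A - set xs)) + card (arcs R (set xs))"
    using closed_longest_path_isolated[of R A ys] ys(2,4) path assms(1,3)
    by (intro card_arcs_le_remove_component) (auto simp: path_in_def)
  also have "card (arcs R (set xs)) \<le> (card (set xs) - 1) * card (set xs)"
    by (rule card_arcs_irrefl_le) (simp_all add: assms(4))
  also have "card (set xs) = length xs" using path by (simp add: path_in_def distinct_card)
  finally show ?thesis by simp
qed

lemma ex_sparse_component:
  assumes "finite A" "symp R" "irreflp R" and no_path: "\<And>xs. path_in R A xs \<Longrightarrow> length xs \<noteq> m"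
    and "A \<noteq> {}" and large_degrees: "\<And>z. z \<in> A \<Longrightarrow> m - 2 < 2 * card {u \<in> A. R z u}"
  shows "\<exists>S\<subseteq>A. S \<noteq> {} \<and> card (arcs R A) \<le> card (arcs R (A - S)) + (m - 2) * card S"
proof -
  obtain xs where xs: "longest_path R A xs" using ex_longest_path[OF assms(1)] by blast
  then have path: "path_in R A xs" by (simp add: longest_path_def)
  then have sub: "set xs \<subseteq> A" and card_xs: "card (set xs) = length xs"
    by (auto simp: path_in_def distinct_card)
  have short: "length xs \<le> m - 1"
    using no_path[OF path_in_take[OF path, of m]] by (cases "m \<le> length xs") auto
  have nonempty: "xs \<noteq> []" using assms(5) longest_path_nonempty[OF xs] by blast
  then have "hd xs \<in> A" "last xs \<in> A" using sub by auto
  then have "m - 2 < 2 * card {u \<in> A. R (hd xs) u}" "m - 2 < 2 * card {u \<in> A. R (last xs) u}"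
    using large_degrees by blast+
  then have "card (arcs R A) \<le> card (arcs R (A - set xs)) + (length xs - 1) * length xs"
    using short by (intro card_arcs_le_remove_longest_path assms(1-3) xs nonempty) linarith
  also have "\<dots> \<le> card (arcs R (A - set xs)) + (m - 2) * card (set xs)"
    unfolding card_xs using short by (intro add_left_mono mult_le_mono1) linarith
  finally show ?thesis using sub nonempty by (intro exI[of _ "set xs"]) simp
qed

theorem erdos_gallai:
  assumes "finite A" "symp R" "irreflp R" and "\<And>xs. path_in R A xs \<Longrightarrow> length xs \<noteq> m"
  shows "card (arcs R A) \<le> (m - 2) * card A"
  using assms(1,4)
proof (induction A rule: finite_psubset_induct)
  case (psubset A)
  have IH: "card (arcs R B) \<le> (m - 2) * card B" if "B \<subset> A" for B
    using psubset.IH[OF that] psubset.prems path_in_mono[OF _ psubset_imp_subset[OF that], of R _ R] by blast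
  consider (empty) "A = {}" | (small_degree) z where "z \<in> A" "2 * card {u \<in> A. R z u} \<le> m - 2"
    | (large_degrees) "A \<noteq> {}" "\<And>z. z \<in> A \<Longrightarrow> m - 2 < 2 * card {u \<in> A. R z u}" by fastforce
  then show ?case
  proof cases
    case empty
    then show ?thesis by (simp add: arcs_def)
  next
    case (small_degree z)
    have "card (arcs R A) \<le> card (arcs R (A - {z})) + 2 * card {u \<in> A. R z u}"
      by (rule card_arcs_le_remove_vertex[OF psubset.hyps assms(2)])
    also have "\<dots> \<le> (m - 2) * card (A - {z}) + (m - 2)"
      using small_degree by (intro add_mono IH) auto
    also have "\<dots> = (m - 2) * card A"
      using card_Suc_Diff1[OF psubset.hyps small_degree(1)] by (metis add.commute mult_Suc_right)
    finally show ?thesis .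
  next
    case large_degrees
    obtain S where S: "S \<subseteq> A" "S \<noteq> {}" "card (arcs R A) \<le> card (arcs R (A - S)) + (m - 2) * card S"
      using ex_sparse_component[OF psubset.hyps assms(2,3) psubset.prems large_degrees] by blast
    have "card (arcs R (A - S)) \<le> (m - 2) * card (A - S)" using S(1,2) by (intro IH) blast
    then have "card (arcs R A) \<le> (m - 2) * (card (A - S) + card S)"
      using S(3) by (simp add: add_mult_distrib2)
    also have "card (A - S) + card S = card A"
      using card_mono[OF psubset.hyps S(1)] finite_subset[OF S(1) psubset.hyps]
      by (simp add: card_Diff_subset S(1))
    finally show ?thesis .
  qed
qed

subsection \<open>Cycles as periodic sequences\<close>

text \<open>Cycles are parametrized by the integers rather than by \<open>{..<m}\<close>, so that rotations and
  reflections become the substitutions \<open>x \<mapsto> c + s * x\<close> with \<open>s \<in> {1, -1}\<close>.\<close>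

definition cyclic :: "nat \<Rightarrow> (int \<Rightarrow> 'a) \<Rightarrow> bool" where
  "cyclic m g \<longleftrightarrow> (\<forall>x y. g x = g y \<longleftrightarrow> int m dvd x - y)"

definition edge_trace :: "(int \<Rightarrow> 'a) \<Rightarrow> 'a set set" where
  "edge_trace g = range (\<lambda>x. {g x, g (x + 1)})"

definition cycle_params :: "nat \<Rightarrow> 'a set set \<Rightarrow> (int \<Rightarrow> 'a) set" where
  "cycle_params m E = {g. cyclic m g \<and> edge_trace g \<subseteq> E}"

lemma cyclic_eq_iff: "cyclic m g \<Longrightarrow> g x = g y \<longleftrightarrow> int m dvd x - y"
  by (simp add: cyclic_def)

lemma cyclic_shift_neq:
  assumes "cyclic m g" "0 < d" "d < int m"
  shows "g (x + d) \<noteq> g x"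
  using assms by (auto simp: cyclic_eq_iff dest: zdvd_imp_le)

lemma cyclic_mod: "cyclic m g \<Longrightarrow> g (x mod int m) = g x"
  by (simp add: cyclic_eq_iff mod_eq_dvd_iff[symmetric])

lemma inj_on_cyclic:
  assumes "cyclic m g"
  shows "inj_on (\<lambda>i. g (int i)) {..<m}"
proof (rule inj_onI)
  fix i j assume ij: "i \<in> {..<m}" "j \<in> {..<m}" "g (int i) = g (int j)"
  then have "int i mod int m = int j mod int m"
    by (simp only: cyclic_eq_iff[OF assms] mod_eq_dvd_iff)
  then show "i = j" using ij(1,2) by simp
qed

lemma cycle_edges_cyclic:
  assumes "cyclic m g" "m > 0"
  shows "cycle_edges (\<lambda>i. g (int i)) m = edge_trace g"
proof -
  have "g (int (Suc i mod m)) = g (int i + 1)" for i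
    using cyclic_mod[OF assms(1), of "int i + 1"] by (simp add: zmod_int add.commute)
  then have "cycle_edges (\<lambda>i. g (int i)) m = (\<lambda>x. {g x, g (x + 1)}) ` int ` {..<m}"
    by (simp add: cycle_edges_def image_image)
  also have "\<dots> = edge_trace g"
    unfolding edge_trace_def
  proof (rule equalityI)
    show "range (\<lambda>x. {g x, g (x + 1)}) \<subseteq> (\<lambda>x. {g x, g (x + 1)}) ` int ` {..<m}"
    proof (rule image_subsetI)
      fix x
      have "x mod int m \<in> int ` {..<m}"
        using assms(2) by (intro image_eqI[of _ _ "nat (x mod int m)"]) (simp_all add: nat_less_iff)
      moreover have "g (x mod int m + 1) = g (x + 1)"
        using cyclic_mod[OF assms(1), of "x mod int m + 1"] cyclic_mod[OF assms(1), of "x + 1"]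
        by (simp add: mod_simps)
      ultimately show "{g x, g (x + 1)} \<in> (\<lambda>x. {g x, g (x + 1)}) ` int ` {..<m}"
        using cyclic_mod[OF assms(1), of x] by (intro image_eqI[of _ _ "x mod int m"]) auto
    qed
  qed auto
  finally show ?thesis .
qed

lemma ex_cyclic_extension:
  assumes "inj_on f {..<m}" "m > 0"
  shows "\<exists>g. cyclic m g \<and> (\<forall>i<m. g (int i) = f i)"
proof (intro exI conjI)
  let ?g = "\<lambda>x. f (nat (x mod int m))"
  have "f (nat (x mod int m)) = f (nat (y mod int m)) \<longleftrightarrow> x mod int m = y mod int m" for x y
    using assms by (subst inj_on_eq_iff[OF assms(1)]) (auto simp: nat_less_iff eq_nat_nat_iff)
  then show "cyclic m ?g" by (simp add: cyclic_def mod_eq_dvd_iff)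
  show "\<forall>i<m. ?g (int i) = f i" by simp
qed

lemma cycle_edges_cong:
  assumes "\<And>i. i < m \<Longrightarrow> f i = g i"
  shows "cycle_edges f m = cycle_edges g m"
  unfolding cycle_edges_def
  by (intro image_cong refl arg_cong2[of _ _ _ _ "\<lambda>u v. {u, v}"] assms) auto

lemma cycle_copies_eq:
  assumes "m > 0"
  shows "cycle_copies m E = edge_trace ` cycle_params m E"
proof (intro equalityI subsetI)
  fix C assume "C \<in> cycle_copies m E"
  then obtain f where f: "inj_on f {..<m}" "C = cycle_edges f m" "C \<subseteq> E"
    by (auto simp: cycle_copies_def)
  then obtain g where g: "cyclic m g" "\<And>i. i < m \<Longrightarrow> g (int i) = f i"
    using ex_cyclic_extension[OF _ assms] by blast
  have "C = edge_trace g"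
    using cycle_edges_cyclic[OF g(1) assms] cycle_edges_cong[of m f "\<lambda>i. g (int i)"] g(2) f(2) by simp
  then show "C \<in> edge_trace ` cycle_params m E" using f(3) g(1) by (auto simp: cycle_params_def)
next
  fix C assume "C \<in> edge_trace ` cycle_params m E"
  then obtain g where g: "cyclic m g" "edge_trace g \<subseteq> E" "C = edge_trace g"
    by (auto simp: cycle_params_def)
  then show "C \<in> cycle_copies m E"
    using inj_on_cyclic[OF g(1)] cycle_edges_cyclic[OF g(1) assms, symmetric] by (auto simp: cycle_copies_def)
qed

lemma edge_trace_reparam:
  assumes "s \<in> {1, -1}"
  shows "edge_trace (\<lambda>x. g (c + s * x)) = edge_trace g"
proof (cases "s = 1")
  case True
  have "edge_trace (\<lambda>x. g (c + s * x)) = (\<lambda>x. {g x, g (x + 1)}) ` range (\<lambda>x. c + x)"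
    unfolding edge_trace_def image_image using True by (simp add: add.assoc)
  then show ?thesis by (simp only: surj_plus edge_trace_def)
next
  case False
  have "range (\<lambda>x. c - 1 - x) = UNIV" by (rule surjI[of _ "\<lambda>x. c - 1 - x"]) simp
  moreover have "edge_trace (\<lambda>x. g (c + s * x)) = (\<lambda>x. {g x, g (x + 1)}) ` range (\<lambda>x. c - 1 - x)"
    unfolding edge_trace_def image_image using False assms
    by (intro image_cong refl) (auto simp: algebra_simps insert_commute)
  ultimately show ?thesis by (simp only: edge_trace_def)
qed

lemma cycle_params_reparam:
  assumes "g \<in> cycle_params m E" "s \<in> {1, -1}"
  shows "(\<lambda>x. g (c + s * x)) \<in> cycle_params m E"
proof -
  have "int m dvd (c + s * x) - (c + s * y) \<longleftrightarrow> int m dvd x - y" for x y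
    using assms(2) by (auto simp: dvd_diff_commute)
  then have "cyclic m (\<lambda>x. g (c + s * x))"
    using assms(1) by (simp add: cycle_params_def cyclic_def)
  then show ?thesis using assms by (simp add: cycle_params_def edge_trace_reparam)
qed

lemma cycle_params_cyclic: "g \<in> cycle_params m E \<Longrightarrow> cyclic m g"
  by (simp add: cycle_params_def)

lemma cycle_params_edge: "g \<in> cycle_params m E \<Longrightarrow> {g x, g (x + 1)} \<in> E"
  by (auto simp: cycle_params_def edge_trace_def)

lemma neighbour_in_edge_trace:
  assumes "cyclic m g" "{g x, v} \<in> edge_trace g"
  shows "v = g (x - 1) \<or> v = g (x + 1)"
proof -
  obtain y where "{g x, v} = {g y, g (y + 1)}" using assms(2) by (auto simp: edge_trace_def)
  then consider (successor) "g x = g y" "v = g (y + 1)" | (predecessor) "g x = g (y + 1)" "v = g y"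
    by (auto simp: doubleton_eq_iff)
  then show ?thesis
  proof cases
    case successor
    then have "g (x + 1) = g (y + 1)" by (simp add: cyclic_eq_iff[OF assms(1)])
    then show ?thesis using successor by simp
  next
    case predecessor
    then have "g (x - 1) = g y" by (simp add: cyclic_eq_iff[OF assms(1)] algebra_simps)
    then show ?thesis using predecessor by simp
  qed
qed

lemma cyclic_eq_if_edge_trace_eq:
  assumes "cyclic m g" "cyclic m h" "m \<ge> 3" "edge_trace g = edge_trace h" "g 0 = h 0" "g 1 = h 1"
  shows "g (int i) = h (int i)"
proof -
  have "g (int i) = h (int i) \<and> g (int i + 1) = h (int i + 1)"
  proof (induction i)
    case 0
    then show ?case using assms(5,6) by simp
  next
    case (Suc i)
    have "{h (int i + 1), h (int i + 2)} \<in> edge_trace h"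
      unfolding edge_trace_def by (rule range_eqI[of _ _ "int i + 1"]) (simp add: add.assoc)
    then have "{g (int i + 1), h (int i + 2)} \<in> edge_trace g" using Suc assms(4) by simp
    then have "h (int i + 2) = g (int i) \<or> h (int i + 2) = g (int i + 2)"
      using neighbour_in_edge_trace[OF assms(1), of "int i + 1"] by (simp add: add.assoc)
    moreover have "h (int i + 2) \<noteq> g (int i)"
      using Suc cyclic_shift_neq[OF assms(2), of 2] assms(3) by simp
    ultimately show ?case using Suc by (simp add: ac_simps)
  qed
  then show ?thesis ..
qed

locale finite_graph =
  fixes V :: "'a set" and E :: "'a set set"
  assumes finite_V: "finite V"
    and edges: "E \<subseteq> {e. \<exists>u v. e = {u, v} \<and> u \<noteq> v \<and> u \<in> V \<and> v \<in> V}"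
begin

definition adj :: "'a \<Rightarrow> 'a \<Rightarrow> bool" where "adj u v \<longleftrightarrow> {u, v} \<in> E"

definition nb :: "'a \<Rightarrow> 'a set" where "nb v = {u. adj v u}"

definition common_nb :: "'a \<Rightarrow> 'a \<Rightarrow> 'a set" where "common_nb a b = nb a \<inter> nb b"

definition codeg :: "'a \<Rightarrow> 'a \<Rightarrow> nat" where "codeg a b = card (common_nb a b)"

definition cherries :: "'a \<Rightarrow> nat" where "cherries a = (\<Sum>b\<in>V - {a}. codeg a b)"

lemma adj_commute: "adj u v \<longleftrightarrow> adj v u"
  by (simp add: adj_def insert_commute)

lemma adj_irrefl: "\<not> adj v v"
  using edges by (auto simp: adj_def doubleton_eq_iff)

lemma symp_adj: "symp adj"
  by (simp add: sympI adj_commute)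

lemma irreflp_adj: "irreflp adj"
  by (simp add: irreflpI adj_irrefl)

lemma adj_in_V:
  assumes "adj u v"
  shows "u \<in> V" "v \<in> V"
  using assms edges by (auto simp: adj_def doubleton_eq_iff)

lemma finite_E: "finite E"
  using finite_V edges by (auto intro: finite_subset[of _ "Pow V"])

lemma in_nb_iff [simp]: "u \<in> nb v \<longleftrightarrow> adj v u"
  by (simp add: nb_def)

lemma nb_subset: "nb v \<subseteq> V"
  using adj_in_V by auto

lemma finite_nb [simp]: "finite (nb v)"
  using finite_subset nb_subset finite_V by blast

lemma card_nb_le: "card (nb v) \<le> card V"
  by (simp add: card_mono finite_V nb_subset)

lemma in_common_nb_iff [simp]: "w \<in> common_nb a b \<longleftrightarrow> adj a w \<and> adj b w"
  by (simp add: common_nb_def)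

lemma finite_common_nb [simp]: "finite (common_nb a b)"
  by (simp add: common_nb_def)

lemma codeg_commute: "codeg a b = codeg b a"
  by (simp add: codeg_def common_nb_def inf_commute)

lemma codeg_self: "codeg a a = card (nb a)"
  by (simp add: codeg_def common_nb_def)

lemma adj_cycle_params: "g \<in> cycle_params m E \<Longrightarrow> adj (g x) (g (x + 1))"
  by (simp add: adj_def cycle_params_edge)

lemma cycle_params_in_V: "g \<in> cycle_params m E \<Longrightarrow> g x \<in> V"
  using adj_cycle_params adj_in_V by blast

lemma finite_cycle_copies: "finite (cycle_copies m E)"
  by (rule finite_subset[of _ "Pow E"]) (auto simp: cycle_copies_def finite_E)

end

subsection \<open>Cherries in even-cycle-free graphs\<close>

locale even_cycle_free = finite_graph +
  fixes k :: nat
  assumes k_ge_2: "k \<ge> 2"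
    and no_cycle: "cycle_copies (2 * k) E = {}"
begin

lemma no_closed_path:
  assumes "path_in adj A xs" "adj (last xs) (hd xs)"
  shows "length xs \<noteq> 2 * k"
proof
  assume length: "length xs = 2 * k"
  then have nonempty: "xs \<noteq> []" using k_ge_2 by auto
  have "{xs ! i, xs ! (Suc i mod (2 * k))} \<in> E" if "i < 2 * k" for i
  proof (cases "Suc i = 2 * k")
    case True
    then have "last xs = xs ! i" using nonempty length by (simp add: last_conv_nth flip: True)
    then show ?thesis using assms(2) nonempty True by (simp add: adj_def hd_conv_nth)
  next
    case False
    then show ?thesis
      using assms(1) that length by (auto simp: path_in_def adj_def dest: successively_nth[of _ _ i])
  qed
  moreover have "inj_on ((!) xs) {..<2 * k}"
    using assms(1) length by (intro inj_on_nth) (auto simp: path_in_def)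
  ultimately have "cycle_edges ((!) xs) (2 * k) \<in> cycle_copies (2 * k) E"
    by (auto simp: cycle_copies_def cycle_edges_def)
  then show False using no_cycle by blast
qed

lemma path_between_nb_length:
  assumes "path_in adj (- {v}) xs" "xs \<noteq> []" "hd xs \<in> nb v" "last xs \<in> nb v"
  shows "length xs \<noteq> 2 * k - 1"
proof -
  have "v \<notin> set xs" using assms(1) by (auto simp: path_in_def)
  then have "path_in adj UNIV (v # xs)"
    using assms path_in_mono[of adj "- {v}" xs UNIV adj] by (simp add: path_in_Cons_iff)
  then have "length (v # xs) \<noteq> 2 * k"
    using assms(2,4) by (intro no_closed_path) (simp_all add: adj_commute)
  then show ?thesis using k_ge_2 by simp
qed

lemma card_arcs_nb_le: "card (arcs adj (nb v)) \<le> (2 * k - 3) * card (nb v)"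
proof -
  have "length xs \<noteq> 2 * k - 1" if "path_in adj (nb v) xs" for xs
  proof (cases "xs = []")
    case True
    then show ?thesis using k_ge_2 by auto
  next
    case False
    then have "hd xs \<in> nb v" "last xs \<in> nb v"
      using that hd_in_set[OF False] last_in_set[OF False] unfolding path_in_def by blast+
    moreover have "path_in adj (- {v}) xs"
      using that by (rule path_in_mono) (auto simp: adj_irrefl)
    ultimately show ?thesis using False by (intro path_between_nb_length)
  qed
  then have "card (arcs adj (nb v)) \<le> (2 * k - 1 - 2) * card (nb v)"
    by (intro erdos_gallai finite_nb symp_adj irreflp_adj)
  then show ?thesis by (simp add: numeral_3_eq_3)
qed

definition crossing :: "'a \<Rightarrow> 'a \<Rightarrow> 'a \<Rightarrow> bool" where
  "crossing v x y \<longleftrightarrow> adj x y \<and> (x \<in> nb v \<longleftrightarrow> y \<notin> nb v)"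

lemma last_crossing_path_iff:
  "successively (crossing v) xs \<Longrightarrow> xs \<noteq> [] \<Longrightarrow>
     last xs \<in> nb v \<longleftrightarrow> (hd xs \<in> nb v \<longleftrightarrow> odd (length xs))"
proof (induction xs)
  case (Cons x xs)
  then show ?case by (cases "xs = []") (auto simp: successively_Cons crossing_def)
qed simp

lemma crossing_path_length:
  assumes "path_in (crossing v) (- {v}) xs"
  shows "length xs \<noteq> 2 * k"
proof
  assume length: "length xs = 2 * k"
  have ends: "\<not> (hd ys \<in> nb v \<and> last ys \<in> nb v)"
    if "path_in (crossing v) (- {v}) ys" "length ys = 2 * k - 1" for ys
    using that k_ge_2 path_between_nb_length[of v ys] path_in_mono[of "crossing v" _ ys "- {v}" adj]
    by (fastforce simp: crossing_def)
  have parity: "last ys \<in> nb v \<longleftrightarrow> hd ys \<in> nb v"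
    if "path_in (crossing v) (- {v}) ys" "length ys = 2 * k - 1" for ys
  proof -
    have "odd (length ys)" "ys \<noteq> []" using that(2) k_ge_2 by auto
    then show ?thesis using that(1) last_crossing_path_iff[of v ys] by (simp add: path_in_def)
  qed
  obtain x y zs where xs: "xs = x # y # zs"
    using length k_ge_2 by (cases xs; cases "tl xs") auto
  have "path_in (crossing v) (- {v}) (butlast xs)" "path_in (crossing v) (- {v}) (tl xs)"
    using path_in_take[OF assms, of "length xs - 1"] path_in_drop[OF assms, of 1]
    by (simp_all add: butlast_conv_take drop_Suc)
  then have "hd (butlast xs) \<notin> nb v" "hd (tl xs) \<notin> nb v"
    using ends parity length by (metis length_butlast, metis length_tl)
  then show False using assms by (simp add: xs path_in_def crossing_def)
qed

lemma card_cherries_ending_outside_nb_le: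
  "card (SIGMA b:V - {v} - nb v. common_nb v b) \<le> (k - 1) * card V"
proof -
  let ?D = "SIGMA b:V - {v} - nb v. common_nb v b"
  let ?A = "arcs (crossing v) (V - {v})"
  have finite_D: "finite ?D" using finite_V by simp
  have "2 * card ?D = card ?D + card (prod.swap ` ?D)" by (simp add: card_image)
  also have "\<dots> = card (?D \<union> prod.swap ` ?D)"
    using finite_D by (intro card_Un_disjoint[symmetric]) auto
  also have "\<dots> \<le> card ?A"
  proof (rule card_mono)
    show "?D \<union> prod.swap ` ?D \<subseteq> ?A"
      using adj_in_V adj_irrefl by (auto simp: arcs_def crossing_def adj_commute)
  qed (simp add: finite_V)
  also have "\<dots> \<le> (2 * k - 2) * card (V - {v})"
  proof (rule erdos_gallai)
    show "symp (crossing v)" "irreflp (crossing v)"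
      by (auto simp: crossing_def adj_commute intro: sympI irreflpI)
    show "length xs \<noteq> 2 * k" if "path_in (crossing v) (V - {v}) xs" for xs
      by (rule crossing_path_length, rule path_in_mono[OF that]) auto
  qed (simp add: finite_V)
  also have "\<dots> \<le> (2 * k - 2) * card V"
    by (intro mult_le_mono2 card_Diff1_le)
  finally show ?thesis by (simp add: diff_mult_distrib)
qed

lemma cherries_le: "cherries v \<le> (k - 1) * card V + 2 * k * card (nb v)"
proof -
  let ?D = "SIGMA b:V - {v} - nb v. common_nb v b"
  have "cherries v = card (SIGMA b:V - {v}. common_nb v b)"
    using finite_V by (simp add: cherries_def codeg_def)
  also have "\<dots> \<le> card (?D \<union> arcs adj (nb v))"
  proof (rule card_mono)
    show "(SIGMA b:V - {v}. common_nb v b) \<subseteq> ?D \<union> arcs adj (nb v)" by (auto simp: arcs_def)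
  qed (simp add: finite_V)
  also have "\<dots> \<le> card ?D + card (arcs adj (nb v))" by (rule card_Un_le)
  also have "\<dots> \<le> (k - 1) * card V + (2 * k - 3) * card (nb v)"
    by (intro add_mono card_cherries_ending_outside_nb_le card_arcs_nb_le)
  also have "\<dots> \<le> (k - 1) * card V + 2 * k * card (nb v)"
    by (intro add_left_mono mult_le_mono1) simp
  finally show ?thesis .
qed

end

subsection \<open>Linked paths\<close>

lemma set_splice: "set (splice xs ys) = set xs \<union> set ys"
  by (rule set_shuffles) simp

lemma distinct_splice:
  assumes "distinct xs" "distinct ys" "set xs \<inter> set ys = {}"
  shows "distinct (splice xs ys)"
  using assms splice_in_shuffles by (rule distinct_disjoint_shuffles)

lemma hd_splice: "xs \<noteq> [] \<Longrightarrow> hd (splice xs ys) = hd xs"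
  by (cases xs) simp_all

lemma last_splice: "length xs = Suc (length ys) \<Longrightarrow> last (splice xs ys) = last xs"
proof (induction ys arbitrary: xs)
  case (Cons y ys)
  then obtain x xs' where xs: "xs = x # xs'" "length xs' = Suc (length ys)" by (cases xs) auto
  then have "xs' \<noteq> []" by auto
  then show ?case using Cons.IH[OF xs(2)] by (simp add: xs(1))
qed simp

fun path_edges :: "'a list \<Rightarrow> 'a set list" where
  "path_edges (u # v # vs) = {u, v} # path_edges (v # vs)"
| "path_edges vs = []"

lemma length_path_edges [simp]: "length (path_edges vs) = length vs - 1"
  by (induction vs rule: path_edges.induct) auto

lemma set_path_edges_subset:
  "successively R vs \<Longrightarrow> set (path_edges vs) \<subseteq> {{u, v} | u v. u \<in> set vs \<and> v \<in> set vs \<and> R u v}"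
  by (induction vs rule: path_edges.induct) (auto; blast)+

lemma distinct_path_edges:
  assumes "distinct vs"
  shows "distinct (path_edges vs)"
  using assms
proof (induction vs rule: path_edges.induct)
  case (1 u v vs)
  have "successively (\<lambda>_ _. True) (v # vs)" by (simp add: successively_conv_nth)
  then have "u \<notin> e" if "e \<in> set (path_edges (v # vs))" for e
    using "1.prems" that set_path_edges_subset[of _ "v # vs"] by fastforce
  then show ?case using 1 by auto
qed simp_all

lemma successively_splice_path_edges:
  assumes "successively R vs" and "\<And>u v. R u v \<Longrightarrow> S u (f {u, v}) \<and> S (f {u, v}) v"
  shows "successively S (splice vs (map f (path_edges vs)))"
  using assms(1)
proof (induction vs rule: path_edges.induct)
  case (1 u v vs)
  then show ?case using assms(2) by (simp add: successively_Cons hd_splice)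
qed simp_all

subsection \<open>Counting quadrilaterals\<close>

context even_cycle_free
begin

definition fat :: "'a \<Rightarrow> 'a \<Rightarrow> bool" where
  "fat a b \<longleftrightarrow> a \<noteq> b \<and> 2 * k \<le> codeg a b"

definition thin :: "'a \<Rightarrow> 'a \<Rightarrow> bool" where
  "thin a b \<longleftrightarrow> a \<noteq> b \<and> codeg a b < 2 * k"

lemma symp_fat: "symp fat" and irreflp_fat: "irreflp fat"
  by (auto simp: fat_def codeg_commute intro: sympI irreflpI)

lemma irreflp_thin: "irreflp thin"
  by (auto simp: thin_def intro: irreflpI)

lemma no_linked_path_in_nb:
  assumes "distinct vs" "set vs \<subseteq> nb b" "length vs = k"
    and "distinct xs" "set xs \<inter> insert b (set vs) = {}" "length xs = k - 1"
  shows "\<not> successively adj (splice vs xs)"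
proof
  assume "successively adj (splice vs xs)"
  moreover have nonempty: "vs \<noteq> []" and lengths: "length vs = Suc (length xs)"
    using assms(3,6) k_ge_2 by auto
  moreover have "b \<notin> set vs" using assms(2) adj_irrefl by auto
  ultimately have path: "path_in adj (- {b}) (splice vs xs)"
    using assms(1,4,5) by (auto simp: path_in_def set_splice intro!: distinct_splice)
  have "hd vs \<in> nb b" "last vs \<in> nb b" using assms(2) nonempty hd_in_set last_in_set by blast+
  then have "length (splice vs xs) \<noteq> 2 * k - 1"
    using nonempty lengths by (intro path_between_nb_length[OF path]) (auto simp: hd_splice last_splice)
  then show False using assms(3,6) by simp
qed

lemma ex_links_of_fat_path:
  assumes "successively fat vs" "finite Z" "card Z + length vs \<le> Suc (2 * k)"
  shows "\<exists>xs. distinct xs \<and> length xs = length vs - 1 \<and> set xs \<inter> Z = {} \<and> successively adj (splice vs xs)"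
  using assms
proof (induction vs arbitrary: Z rule: induct_list012)
  case (3 u v vs)
  have "card Z < 2 * k" using "3.prems"(3) by simp
  also have "\<dots> \<le> card (common_nb u v)" using "3.prems"(1) by (simp add: fat_def codeg_def)
  finally have "\<not> common_nb u v \<subseteq> Z"
    using card_mono[OF \<open>finite Z\<close>] by (meson not_le)
  then obtain x where "x \<in> common_nb u v" and x_notin: "x \<notin> Z" by blast
  then have x: "adj u x" "adj v x" by simp_all
  have "\<exists>xs. distinct xs \<and> length xs = length (v # vs) - 1 \<and> set xs \<inter> insert x Z = {} \<and>
      successively adj (splice (v # vs) xs)"
    using "3.prems" x_notin by (intro "3.IH"(2)) auto
  then obtain xs where xs: "distinct xs" "length xs = length vs" "x \<notin> set xs" "set xs \<inter> Z = {}"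
    "successively adj (splice (v # vs) xs)" by auto
  then have "successively adj (splice (u # v # vs) (x # xs))"
    using x by (simp add: successively_Cons hd_splice adj_commute)
  then show ?case using xs x_notin by (intro exI[of _ "x # xs"]) simp
qed (auto intro: exI[of _ "[]"])

lemma card_arcs_fat_le:
  assumes "A \<subseteq> nb b"
  shows "card (arcs fat A) \<le> (k - 2) * card A"
proof (rule erdos_gallai)
  show "finite A" using assms by (rule finite_subset) simp
  show "length vs \<noteq> k" if "path_in fat A vs" for vs
  proof
    assume length: "length vs = k"
    have vs: "distinct vs" "set vs \<subseteq> nb b" "successively fat vs"
      using that assms by (auto simp: path_in_def)
    have "card (insert b (set vs)) \<le> Suc k"
      using card_insert_le_m1[of "Suc k" "set vs" b] card_length[of vs] length by simp
    then obtain xs where "distinct xs" "length xs = k - 1" "set xs \<inter> insert b (set vs) = {}"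
      "successively adj (splice vs xs)"
      using ex_links_of_fat_path[OF vs(3), of "insert b (set vs)"] length by auto
    then show False using no_linked_path_in_nb[OF vs(1,2) length] by blast
  qed
qed (rule symp_fat irreflp_fat)+

lemma card_linked_arcs_le:
  assumes "symp R" "irreflp R"
    and inj: "inj_on link {{u, v} | u v. R u v}"
    and link: "\<And>u v. R u v \<Longrightarrow> adj u (link {u, v}) \<and> adj (link {u, v}) v"
    and outside: "\<And>u v. R u v \<Longrightarrow> link {u, v} \<notin> insert b (nb b)"
  shows "card (arcs R (nb b)) \<le> (k - 2) * card (nb b)"
proof (rule erdos_gallai[OF finite_nb assms(1,2)])
  show "length vs \<noteq> k" if path: "path_in R (nb b) vs" for vs
  proof
    assume length: "length vs = k"
    have vs: "distinct vs" "set vs \<subseteq> nb b" "successively R vs" using path by (auto simp: path_in_def)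
    have edges: "set (path_edges vs) \<subseteq> {{u, v} | u v. R u v}"
      using set_path_edges_subset[OF vs(3)] by blast
    let ?xs = "map link (path_edges vs)"
    have "distinct ?xs"
      using distinct_path_edges[OF vs(1)] inj_on_subset[OF inj edges] by (simp add: distinct_map)
    moreover have "set ?xs \<inter> insert b (set vs) = {}" using edges outside vs(2) by fastforce
    moreover have "successively adj (splice vs ?xs)"
      using successively_splice_path_edges[OF vs(3), of adj link] link by blast
    ultimately show False using no_linked_path_in_nb[OF vs(1,2) length, of ?xs] length by simp
  qed
qed

lemma two_card_chosen_pairs_le:
  assumes outside: "X \<inter> insert b (nb b) = {}"
    and chosen: "\<And>a. a \<in> X \<Longrightarrow> \<exists>u v. pair a = {u, v} \<and> (u, v) \<in> arcs (\<noteq>) (common_nb a b)"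
  shows "2 * card (pair ` X) \<le> (k - 2) * card (nb b)"
proof -
  let ?P = "pair ` X" and ?link = "inv_into X pair"
  let ?R = "\<lambda>u v. u \<noteq> v \<and> {u, v} \<in> ?P"
  have link: "?link {u, v} \<in> X" "adj u (?link {u, v})" "adj (?link {u, v}) v" if "?R u v" for u v
  proof -
    show in_X: "?link {u, v} \<in> X" using that by (intro inv_into_into) simp
    have "pair (?link {u, v}) = {u, v}" using that by (intro f_inv_into_f) simp
    then show "adj u (?link {u, v})" "adj (?link {u, v}) v"
      using chosen[OF in_X] by (auto simp: arcs_def doubleton_eq_iff adj_commute)
  qed
  have "?P \<subseteq> {{u, v} | u v. u \<in> nb b \<and> v \<in> nb b \<and> u \<noteq> v}"
    using chosen by (fastforce simp: arcs_def)
  then have "2 * card ?P \<le> card (arcs ?R (nb b))"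
    by (rule two_card_doubletons_le_card_arcs[OF finite_nb])
  also have "\<dots> \<le> (k - 2) * card (nb b)"
  proof (rule card_linked_arcs_le[where link = ?link])
    show "inj_on ?link {{u, v} | u v. ?R u v}"
      by (rule inj_on_subset[OF inj_on_inv_into[of ?P]]) auto
    show "?link {u, v} \<notin> insert b (nb b)" if "?R u v" for u v
      using link(1)[OF that] outside by blast
  qed (use link in \<open>auto simp: insert_commute intro: sympI irreflpI\<close>)
  finally show ?thesis .
qed

definition thin_partners :: "'a \<Rightarrow> 'a set" where
  "thin_partners b = {a \<in> V. thin a b \<and> arcs thin (common_nb a b) \<noteq> {}}"

lemma card_thin_partners_outside_nb_le:
  "card (thin_partners b - nb b) \<le> k\<^sup>2 * card (nb b)"
proof -
  let ?X = "thin_partners b - nb b"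
  have "\<forall>a\<in>?X. \<exists>e u v. e = {u, v} \<and> (u, v) \<in> arcs thin (common_nb a b)"
    by (auto simp: thin_partners_def simp flip: ex_in_conv)
  from bchoice[OF this] obtain pair
    where "\<forall>a\<in>?X. \<exists>u v. pair a = {u, v} \<and> (u, v) \<in> arcs thin (common_nb a b)" ..
  note pair = bspec[OF this]
  have "card ?X \<le> 2 * k * card (pair ` ?X)"
  proof (rule card_le_mult_card_if_fibres_le[of _ _ pair])
    fix e assume "e \<in> pair ` ?X"
    then obtain a where a: "a \<in> ?X" "e = pair a" by blast
    obtain u v where e: "e = {u, v}" "codeg u v < 2 * k"
      using pair[OF a(1)] a(2) by (auto simp: arcs_def thin_def)
    have "{a \<in> ?X. pair a = e} \<subseteq> common_nb u v"
    proof (rule subsetI)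
      fix a assume "a \<in> {a \<in> ?X. pair a = e}"
      then have "a \<in> ?X" "pair a = {u, v}" by (simp_all add: e(1))
      then show "a \<in> common_nb u v"
        using pair[of a] by (auto simp: arcs_def adj_commute doubleton_eq_iff)
    qed
    then have "card {a \<in> ?X. pair a = e} \<le> codeg u v"
      unfolding codeg_def by (intro card_mono) simp_all
    then show "card {a \<in> ?X. pair a = e} \<le> 2 * k" using e(2) by simp
  qed (use finite_V in \<open>simp_all add: thin_partners_def\<close>)
  also have "\<dots> = k * (2 * card (pair ` ?X))" by simp
  also have "\<dots> \<le> k * ((k - 2) * card (nb b))"
  proof (intro mult_le_mono2 two_card_chosen_pairs_le)
    show "\<exists>u v. pair a = {u, v} \<and> (u, v) \<in> arcs (\<noteq>) (common_nb a b)" if "a \<in> ?X" for a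
      using pair[OF that] unfolding arcs_def thin_def by blast
  qed (auto simp: thin_partners_def thin_def)
  also have "\<dots> \<le> k\<^sup>2 * card (nb b)" by (simp add: power2_eq_square)
  finally show ?thesis .
qed

lemma card_thin_partners_le: "card (thin_partners b) \<le> (1 + k\<^sup>2) * card (nb b)"
proof -
  have "card (thin_partners b) \<le> card (nb b \<union> (thin_partners b - nb b))"
    using finite_V by (intro card_mono) (auto simp: thin_partners_def)
  also have "\<dots> \<le> card (nb b) + card (thin_partners b - nb b)" by (rule card_Un_le)
  also have "\<dots> \<le> card (nb b) + k\<^sup>2 * card (nb b)"
    by (intro add_left_mono card_thin_partners_outside_nb_le)
  finally show ?thesis by simp
qed

text \<open>A quadrilateral is given by its two diagonals, each with an orientation.\<close>

definition quads :: "('a \<Rightarrow> 'a \<Rightarrow> bool) \<Rightarrow> ('a \<Rightarrow> 'a \<Rightarrow> bool) \<Rightarrow> (('a \<times> 'a) \<times> ('a \<times> 'a)) set" where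
  "quads P Q = (SIGMA (a, b):arcs P V. arcs Q (common_nb a b))"

lemma in_quads_iff:
  "((a, b), (u, v)) \<in> quads P Q \<longleftrightarrow> P a b \<and> Q u v \<and> adj a u \<and> adj a v \<and> adj b u \<and> adj b v"
  using adj_in_V by (auto simp: quads_def arcs_def)

lemma finite_quads [simp]: "finite (quads P Q)"
  using finite_V by (auto simp: quads_def)

lemma card_quads_commute: "card (quads P Q) = card (quads Q P)"
proof -
  have "quads Q P = prod.swap ` quads P Q"
  proof (intro equalityI subsetI)
    fix q assume "q \<in> quads Q P"
    then have "prod.swap q \<in> quads P Q"
      by (cases q; cases "fst q"; cases "snd q") (auto simp: in_quads_iff adj_commute)
    then show "q \<in> prod.swap ` quads P Q" by (rule rev_image_eqI) simp
  qed (auto simp: in_quads_iff adj_commute)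
  then show ?thesis by (simp add: card_image)
qed

lemma sum_arcs_neq: "(\<Sum>(a, b)\<in>arcs (\<noteq>) V. f a b) = (\<Sum>a\<in>V. \<Sum>b\<in>V - {a}. f a b)"
proof -
  have "arcs (\<noteq>) V = (SIGMA a:V. V - {a})" by (auto simp: arcs_def)
  then show ?thesis using finite_V by (simp add: sum.Sigma)
qed

lemma card_quads_neq:
  "card (quads (\<noteq>) Q) = (\<Sum>a\<in>V. \<Sum>b\<in>V - {a}. card (arcs Q (common_nb a b)))"
proof -
  have "card (quads (\<noteq>) Q) = (\<Sum>(a, b)\<in>arcs (\<noteq>) V. card (arcs Q (common_nb a b)))"
    unfolding quads_def using finite_V by (subst card_SigmaI) (auto intro!: sum.cong)
  then show ?thesis by (simp add: sum_arcs_neq)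
qed

lemma card_quads_neq_fat_le: "card (quads (\<noteq>) fat) \<le> (k - 2) * (\<Sum>a\<in>V. cherries a)"
  unfolding card_quads_neq cherries_def codeg_def sum_distrib_left
  by (intro sum_mono card_arcs_fat_le) (auto simp: common_nb_def)

lemma card_quads_thin_thin_le:
  "card (quads thin thin) \<le> (2 * k)\<^sup>2 * (1 + k\<^sup>2) * (\<Sum>b\<in>V. card (nb b))"
proof -
  let ?T = "SIGMA b:V. SIGMA a:thin_partners b. arcs thin (common_nb a b)"
  have finite_T: "finite ?T"
    using finite_V by (intro finite_SigmaI) (auto simp: thin_partners_def)
  have "quads thin thin \<subseteq> (\<lambda>(b, a, p). ((a, b), p)) ` ?T"
    by (force simp: quads_def thin_partners_def arcs_def image_iff)
  then have "card (quads thin thin) \<le> card ?T"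
    using finite_T by (rule surj_card_le[rotated])
  also have "\<dots> = (\<Sum>b\<in>V. \<Sum>a\<in>thin_partners b. card (arcs thin (common_nb a b)))"
    using finite_V by (simp add: thin_partners_def)
  also have "\<dots> \<le> (\<Sum>b\<in>V. \<Sum>a\<in>thin_partners b. (2 * k)\<^sup>2)"
  proof (intro sum_mono)
    fix a b assume "a \<in> thin_partners b"
    then have "codeg a b \<le> 2 * k" by (simp add: thin_partners_def thin_def)
    then have "(codeg a b - 1) * codeg a b \<le> (2 * k)\<^sup>2"
      unfolding power2_eq_square by (intro mult_le_mono) simp_all
    then show "card (arcs thin (common_nb a b)) \<le> (2 * k)\<^sup>2"
      using card_arcs_irrefl_le[OF finite_common_nb irreflp_thin, of a b] by (simp add: codeg_def)
  qed
  also have "\<dots> = (2 * k)\<^sup>2 * (\<Sum>b\<in>V. card (thin_partners b))"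
    by (simp add: sum_distrib_left mult.commute[of "card _"])
  also have "\<dots> \<le> (2 * k)\<^sup>2 * (\<Sum>b\<in>V. (1 + k\<^sup>2) * card (nb b))"
    by (intro mult_le_mono2 sum_mono card_thin_partners_le)
  finally show ?thesis by (simp only: sum_distrib_left mult.assoc)
qed

lemma sum_codeg_square_le:
  "(\<Sum>a\<in>V. \<Sum>b\<in>V - {a}. (codeg a b)\<^sup>2) \<le>
     (2 * k - 3) * (\<Sum>a\<in>V. cherries a) + (2 * k)\<^sup>2 * (1 + k\<^sup>2) * (\<Sum>b\<in>V. card (nb b))"
proof -
  let ?C = "\<Sum>a\<in>V. cherries a"
  have square: "(codeg a b)\<^sup>2 = codeg a b + card (arcs (\<noteq>) (common_nb a b))" for a b
    unfolding codeg_def card_arcs_neq[OF finite_common_nb]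
    by (cases "card (common_nb a b)") (simp_all add: power2_eq_square)
  have "quads (\<noteq>) (\<noteq>) \<subseteq> quads (\<noteq>) fat \<union> (quads fat thin \<union> quads thin thin)"
    by (auto simp: in_quads_iff fat_def thin_def)
  then have "card (quads (\<noteq>) (\<noteq>)) \<le> card (quads (\<noteq>) fat \<union> (quads fat thin \<union> quads thin thin))"
    by (rule card_mono[rotated]) simp
  also have "\<dots> \<le> card (quads (\<noteq>) fat) + (card (quads fat thin) + card (quads thin thin))"
    by (meson add_left_mono card_Un_le order_trans)
  also have "card (quads fat thin) \<le> card (quads (\<noteq>) fat)"
    unfolding card_quads_commute[of fat thin] by (intro card_mono) (auto simp: in_quads_iff thin_def)
  finally have "card (quads (\<noteq>) (\<noteq>)) \<le> 2 * (k - 2) * ?C + (2 * k)\<^sup>2 * (1 + k\<^sup>2) * (\<Sum>b\<in>V. card (nb b))"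
    using card_quads_neq_fat_le card_quads_thin_thin_le by linarith
  moreover have "(\<Sum>a\<in>V. \<Sum>b\<in>V - {a}. (codeg a b)\<^sup>2) = ?C + card (quads (\<noteq>) (\<noteq>))"
    by (simp add: square sum.distrib cherries_def card_quads_neq)
  moreover have "?C + 2 * (k - 2) * ?C = (2 * k - 3) * ?C"
  proof -
    have "2 * k - 3 = Suc (2 * (k - 2))" using k_ge_2 by simp
    then show ?thesis by simp
  qed
  ultimately show ?thesis by linarith
qed

end

subsection \<open>Weighted closed walks\<close>

fun walk_weight :: "'a set \<Rightarrow> ('a \<Rightarrow> 'a \<Rightarrow> 'b) \<Rightarrow> nat \<Rightarrow> 'a \<Rightarrow> 'a \<Rightarrow> 'b::comm_semiring_1" where
  "walk_weight V w 0 a b = of_bool (a = b)"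
| "walk_weight V w (Suc j) a b = (\<Sum>c\<in>V. w a c * walk_weight V w j c b)"

locale bounded_weights =
  fixes V :: "'a set" and w :: "'a \<Rightarrow> 'a \<Rightarrow> 'b::linordered_field" and R :: 'b
  assumes finite_vertices: "finite V"
    and weight_nonneg: "0 \<le> w a b"
    and row_sum_le: "(\<Sum>b\<in>V. w a b) \<le> R"
    and column_sum_le: "(\<Sum>a\<in>V. w a b) \<le> R"
begin

lemma bound_nonneg: "0 \<le> R"
  using sum_nonneg[of V "w a" for a] row_sum_le weight_nonneg by (meson order_trans)

lemma walk_weight_nonneg: "0 \<le> walk_weight V w j a b"
  by (induction j arbitrary: a) (auto intro!: sum_nonneg mult_nonneg_nonneg weight_nonneg)

lemma sum_walk_weight_from_le: "(\<Sum>b\<in>V. walk_weight V w j a b) \<le> R ^ j"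
proof (induction j arbitrary: a)
  case 0
  show ?case using finite_vertices by (simp add: of_bool_def)
next
  case (Suc j)
  have "(\<Sum>b\<in>V. walk_weight V w (Suc j) a b) = (\<Sum>c\<in>V. w a c * (\<Sum>b\<in>V. walk_weight V w j c b))"
    by (simp add: sum_distrib_left) (rule sum.swap)
  also have "\<dots> \<le> (\<Sum>c\<in>V. w a c * R ^ j)"
    by (intro sum_mono mult_left_mono Suc weight_nonneg)
  also have "\<dots> \<le> R * R ^ j"
    unfolding sum_distrib_right[symmetric] using bound_nonneg by (intro mult_right_mono row_sum_le) simp
  finally show ?case by simp
qed

lemma sum_walk_weight_to_le: "(\<Sum>a\<in>V. walk_weight V w j a b) \<le> R ^ j"
proof (induction j)
  case 0
  show ?case using finite_vertices by (simp add: of_bool_def)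
next
  case (Suc j)
  have "(\<Sum>a\<in>V. walk_weight V w (Suc j) a b) = (\<Sum>c\<in>V. (\<Sum>a\<in>V. w a c) * walk_weight V w j c b)"
    by (simp add: sum_distrib_right) (rule sum.swap)
  also have "\<dots> \<le> (\<Sum>c\<in>V. R * walk_weight V w j c b)"
    by (intro sum_mono mult_right_mono column_sum_le walk_weight_nonneg)
  also have "\<dots> \<le> R * R ^ j"
    unfolding sum_distrib_left[symmetric] using Suc bound_nonneg by (rule mult_left_mono)
  finally show ?case by simp
qed

lemma sum_closed_walk_weight_le:
  "(\<Sum>a\<in>V. walk_weight V w (j + 2) a a) \<le> R ^ j * (\<Sum>a\<in>V. \<Sum>b\<in>V. (w a b)\<^sup>2)"
proof -
  let ?W = "walk_weight V w j" and ?S = "\<Sum>a\<in>V. \<Sum>b\<in>V. (w a b)\<^sup>2"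
  have "2 * (\<Sum>a\<in>V. walk_weight V w (j + 2) a a) = (\<Sum>a\<in>V. \<Sum>b\<in>V. \<Sum>c\<in>V. (2 * w a b * w b c) * ?W c a)"
    by (simp add: sum_distrib_left mult_ac)
  also have "\<dots> \<le> (\<Sum>a\<in>V. \<Sum>b\<in>V. \<Sum>c\<in>V. ((w a b)\<^sup>2 + (w b c)\<^sup>2) * ?W c a)"
    by (intro sum_mono mult_right_mono sum_squares_bound walk_weight_nonneg)
  also have "\<dots> = (\<Sum>a\<in>V. \<Sum>b\<in>V. \<Sum>c\<in>V. (w a b)\<^sup>2 * ?W c a) + (\<Sum>a\<in>V. \<Sum>b\<in>V. \<Sum>c\<in>V. (w b c)\<^sup>2 * ?W c a)"
    by (simp add: sum.distrib distrib_right)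
  also have "(\<Sum>a\<in>V. \<Sum>b\<in>V. \<Sum>c\<in>V. (w a b)\<^sup>2 * ?W c a) = (\<Sum>a\<in>V. \<Sum>b\<in>V. (w a b)\<^sup>2 * (\<Sum>c\<in>V. ?W c a))"
    by (simp add: sum_distrib_left)
  also have "\<dots> \<le> (\<Sum>a\<in>V. \<Sum>b\<in>V. (w a b)\<^sup>2 * R ^ j)"
    by (intro sum_mono mult_left_mono sum_walk_weight_to_le) simp
  also have "\<dots> = R ^ j * ?S" by (simp add: sum_distrib_left mult.commute)
  also have "(\<Sum>a\<in>V. \<Sum>b\<in>V. \<Sum>c\<in>V. (w b c)\<^sup>2 * ?W c a) = (\<Sum>b\<in>V. \<Sum>a\<in>V. \<Sum>c\<in>V. (w b c)\<^sup>2 * ?W c a)"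
    by (rule sum.swap)
  also have "\<dots> = (\<Sum>b\<in>V. \<Sum>c\<in>V. \<Sum>a\<in>V. (w b c)\<^sup>2 * ?W c a)"
    by (intro sum.cong refl sum.swap)
  also have "\<dots> = (\<Sum>b\<in>V. \<Sum>c\<in>V. (w b c)\<^sup>2 * (\<Sum>a\<in>V. ?W c a))"
    by (simp add: sum_distrib_left)
  also have "\<dots> \<le> (\<Sum>b\<in>V. \<Sum>c\<in>V. (w b c)\<^sup>2 * R ^ j)"
    by (intro sum_mono mult_left_mono sum_walk_weight_from_le) simp
  also have "\<dots> = R ^ j * ?S" by (simp add: sum_distrib_left mult.commute)
  finally show ?thesis by simp
qed

end

subsection \<open>Even cycles as closed walks on a parity class\<close>

definition segment :: "(int \<Rightarrow> 'a) \<Rightarrow> nat \<Rightarrow> 'a list" where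
  "segment g n = map (\<lambda>i. g (int i)) [0..<n]"

lemma length_segment [simp]: "length (segment g n) = n"
  by (simp add: segment_def)

lemma nth_segment [simp]: "i < n \<Longrightarrow> segment g n ! i = g (int i)"
  by (simp add: segment_def)

lemma cycle_edges_segment:
  assumes "cyclic m g" "0 < m" "m \<le> n"
  shows "cycle_edges ((!) (segment g n)) m = edge_trace g"
  using assms cycle_edges_cong[of m "(!) (segment g n)" "\<lambda>i. g (int i)"]
  by (simp add: cycle_edges_cyclic)

lemma segment_Suc_Suc: "segment g (Suc (Suc n)) = g 0 # g 1 # segment (\<lambda>x. g (2 + x)) n"
  by (simp add: segment_def map_upt_Suc del: upt_Suc)

lemma segment_cyclic_split:
  assumes "cyclic m g" "i < m"
  shows "segment g m = segment g i @ g (int i) # rev (tl (segment (\<lambda>x. g (- x)) (m - i)))"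
proof (rule nth_equalityI)
  fix n assume "n < length (segment g m)"
  then have n: "n < m" by simp
  have "g (- int (m - n)) = g (int n)"
    using n by (simp add: cyclic_eq_iff[OF assms(1)])
  then show "segment g m ! n = (segment g i @ g (int i) # rev (tl (segment (\<lambda>x. g (- x)) (m - i)))) ! n"
    using n assms(2) by (auto simp: nth_append nth_Cons' rev_nth nth_tl Suc_diff_Suc)
qed (use assms(2) in simp)

lemma inj_on_segment_reparam:
  assumes g: "cyclic (2 * l) g" and l: "2 \<le> l" and n: "2 \<le> n"
  shows "inj_on (\<lambda>(j, s). segment (\<lambda>x. g (2 * int j + s * x)) n) ({..<l} \<times> {1, -1})"
proof (rule inj_onI)
  let ?walk = "\<lambda>(j, s). segment (\<lambda>x. g (2 * int j + s * x)) n"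
  fix p p' :: "nat \<times> int"
  assume in_domain: "p \<in> {..<l} \<times> {1, -1}" "p' \<in> {..<l} \<times> {1, -1}" and eq: "?walk p = ?walk p'"
  obtain j s j' s' where p: "p = (j, s)" "p' = (j', s')" by (metis surj_pair)
  have j: "j < l" "j' < l" and s: "s \<in> {1, -1}" "s' \<in> {1, -1}" using in_domain by (auto simp: p)
  have agree: "g (2 * int j + s * int i) = g (2 * int j' + s' * int i)" if "i < n" for i
    using arg_cong[OF eq, of "\<lambda>xs. xs ! i"] that by (simp add: p)
  have "int (2 * l) dvd 2 * int j - 2 * int j'"
    using agree[of 0] n by (simp add: cyclic_eq_iff[OF g])
  then have "(2 * int j) mod int (2 * l) = (2 * int j') mod int (2 * l)" by (simp only: mod_eq_dvd_iff)
  then have j_eq: "j = j'" using j by simp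
  have "int (2 * l) dvd s - s'"
    using agree[of 1] n by (simp add: cyclic_eq_iff[OF g] j_eq)
  moreover have "\<not> int (2 * l) dvd 2" using l by (auto dest: zdvd_imp_le)
  ultimately have "s = s'" using s by auto
  then show "p = p'" by (simp add: p j_eq)
qed

context finite_graph
begin

text \<open>Two consecutive edges of a cycle are one step of a walk, so that the set L restricts the
  vertices of one parity class only.\<close>

fun walks :: "'a set \<Rightarrow> nat \<Rightarrow> 'a \<Rightarrow> 'a \<Rightarrow> 'a list set" where
  "walks L 0 a b = (if a = b then {[a]} else {})"
| "walks L (Suc j) a b =
     (\<Union>c\<in>{c \<in> V. a \<in> L \<and> c \<in> L \<and> a \<noteq> c}. \<Union>x\<in>common_nb a c. (\<lambda>ys. a # x # ys) ` walks L j c b)"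

definition codeg_weight :: "'a set \<Rightarrow> 'a \<Rightarrow> 'a \<Rightarrow> real" where
  "codeg_weight L a b = (if a \<in> L \<and> b \<in> L \<and> a \<noteq> b then real (codeg a b) else 0)"

lemma finite_walks [simp]: "finite (walks L j a b)"
  by (induction j arbitrary: a) (auto simp: finite_V)

lemma card_walks_le: "real (card (walks L j a b)) \<le> walk_weight V (codeg_weight L) j a b"
proof (induction j arbitrary: a)
  case (Suc j)
  let ?C = "{c \<in> V. a \<in> L \<and> c \<in> L \<and> a \<noteq> c}"
  let ?W = "\<lambda>c. \<Union>x\<in>common_nb a c. (\<lambda>ys. a # x # ys) ` walks L j c b"
  have "card (?W c) \<le> codeg a c * card (walks L j c b)" for c
  proof -
    have "card (?W c) \<le> (\<Sum>x\<in>common_nb a c. card ((\<lambda>ys. a # x # ys) ` walks L j c b))"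
      by (intro card_UN_le) simp
    also have "\<dots> \<le> (\<Sum>x\<in>common_nb a c. card (walks L j c b))"
      by (intro sum_mono card_image_le) simp
    finally show ?thesis by (simp add: codeg_def)
  qed
  then have "card (walks L (Suc j) a b) \<le> (\<Sum>c\<in>?C. codeg a c * card (walks L j c b))"
    using finite_V by (auto intro!: order_trans[OF card_UN_le sum_mono])
  then have "real (card (walks L (Suc j) a b)) \<le> (\<Sum>c\<in>?C. real (codeg a c) * real (card (walks L j c b)))"
    by (simp only: of_nat_le_iff flip: of_nat_mult of_nat_sum)
  also have "\<dots> \<le> (\<Sum>c\<in>?C. real (codeg a c) * walk_weight V (codeg_weight L) j c b)"
    by (intro sum_mono mult_left_mono Suc) simp
  also have "\<dots> = (\<Sum>c\<in>?C. codeg_weight L a c * walk_weight V (codeg_weight L) j c b)"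
    by (intro sum.cong) (auto simp: codeg_weight_def)
  also have "\<dots> = (\<Sum>c\<in>V. codeg_weight L a c * walk_weight V (codeg_weight L) j c b)"
    using finite_V by (intro sum.mono_neutral_left) (auto simp: codeg_weight_def)
  finally show ?case by simp
qed simp

lemma sum_codeg_weight_le:
  assumes "\<And>a. a \<in> L \<Longrightarrow> real (cherries a) \<le> R" "0 \<le> R"
  shows "(\<Sum>b\<in>V. codeg_weight L a b) \<le> R"
proof (cases "a \<in> L")
  case True
  have "(\<Sum>b\<in>V. codeg_weight L a b) = (\<Sum>b\<in>V - {a}. codeg_weight L a b)"
    using finite_V by (intro sum.mono_neutral_right) (auto simp: codeg_weight_def)
  also have "\<dots> \<le> (\<Sum>b\<in>V - {a}. real (codeg a b))"
    by (intro sum_mono) (simp add: codeg_weight_def)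
  finally show ?thesis using assms(1)[OF True] by (simp add: cherries_def)
qed (simp add: codeg_weight_def assms(2))

lemma bounded_weights_codeg_weight:
  assumes "\<And>a. a \<in> L \<Longrightarrow> real (cherries a) \<le> R" "0 \<le> R"
  shows "bounded_weights V (codeg_weight L) R"
proof
  have commute: "codeg_weight L a b = codeg_weight L b a" for a b
    by (auto simp: codeg_weight_def codeg_commute)
  show "(\<Sum>a\<in>V. codeg_weight L a b) \<le> R" for b
    using sum_codeg_weight_le[OF assms] by (simp add: commute[of _ b])
  show "(\<Sum>b\<in>V. codeg_weight L a b) \<le> R" for a
    by (rule sum_codeg_weight_le[OF assms])
qed (simp_all add: finite_V codeg_weight_def)

lemma segment_in_walks:
  assumes "g \<in> cycle_params m E" "2 < m" and "\<And>i. i \<le> j \<Longrightarrow> g (2 * int i) \<in> L"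
  shows "segment g (2 * j + 1) \<in> walks L j (g 0) (g (2 * int j))"
  using assms(1,3)
proof (induction j arbitrary: g)
  case (Suc j)
  let ?h = "\<lambda>x. g (2 + x)"
  have "?h \<in> cycle_params m E" using cycle_params_reparam[OF Suc.prems(1), of 1 2] by simp
  then have "segment ?h (2 * j + 1) \<in> walks L j (?h 0) (?h (2 * int j))"
    using Suc.prems(2)[of "Suc _"] by (intro Suc.IH) (simp_all add: algebra_simps)
  then have tail: "segment ?h (2 * j + 1) \<in> walks L j (g 2) (g (2 * int (Suc j)))"
    by (simp add: algebra_simps)
  have "adj (g 0) (g 1)" "adj (g 1) (g 2)"
    using adj_cycle_params[OF Suc.prems(1), of 0] adj_cycle_params[OF Suc.prems(1), of 1] by simp_all
  then have mid: "g 1 \<in> common_nb (g 0) (g 2)" by (simp add: adj_commute)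
  have "g 0 \<noteq> g 2"
    using cyclic_shift_neq[OF cycle_params_cyclic[OF Suc.prems(1)], of 2 0] assms(2) by simp
  then have "g 2 \<in> {c \<in> V. g 0 \<in> L \<and> c \<in> L \<and> g 0 \<noteq> c}"
    using Suc.prems(2)[of 0] Suc.prems(2)[of 1] cycle_params_in_V[OF Suc.prems(1)] by simp
  moreover have "segment g (2 * Suc j + 1) = g 0 # g 1 # segment ?h (2 * j + 1)"
    by (simp add: segment_Suc_Suc)
  ultimately show ?case using mid tail unfolding walks.simps by blast
qed (simp add: segment_def)

lemma segment_in_closed_walks:
  assumes "g \<in> cycle_params (2 * l) E" "2 \<le> l" and "\<And>x. g (2 * x) \<in> L"
  shows "segment g (2 * l + 1) \<in> (\<Union>a\<in>V. walks L l a a)"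
proof -
  have "2 < 2 * l" using assms(2) by linarith
  then have "segment g (2 * l + 1) \<in> walks L l (g 0) (g (2 * int l))"
    by (intro segment_in_walks[OF assms(1)] assms(3))
  moreover have "g (2 * int l) = g 0"
    using cyclic_eq_iff[OF cycle_params_cyclic[OF assms(1)], of "2 * int l" 0] by simp
  ultimately show ?thesis using cycle_params_in_V[OF assms(1)] by auto
qed

definition even_copies :: "'a set \<Rightarrow> nat \<Rightarrow> 'a set set set" where
  "even_copies L l = edge_trace ` {g \<in> cycle_params (2 * l) E. \<forall>x. g (2 * x) \<in> L}"

text \<open>Rotations by an even amount and reflections keep the parity class, so every cycle gives
  2l closed walks.\<close>

lemma card_closed_walks_of_cycle_ge:
  assumes g: "g \<in> cycle_params (2 * l) E" "\<And>x. g (2 * x) \<in> L" and l: "2 \<le> l"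
  shows "2 * l \<le> card {xs \<in> \<Union>a\<in>V. walks L l a a. cycle_edges ((!) xs) (2 * l) = edge_trace g}"
    (is "_ \<le> card ?F")
proof -
  let ?D = "{..<l} \<times> {1, -1 :: int}"
  let ?walk = "\<lambda>(j, s). segment (\<lambda>x. g (2 * int j + s * x)) (2 * l + 1)"
  have "?walk ` ?D \<subseteq> ?F"
  proof (rule image_subsetI)
    fix p assume "p \<in> ?D"
    then obtain j s where p: "p = (j, s)" and s: "s \<in> {1, -1}" by blast
    let ?h = "\<lambda>x. g (2 * int j + s * x)"
    have h: "?h \<in> cycle_params (2 * l) E" by (rule cycle_params_reparam[OF g(1) s])
    have "?h (2 * x) \<in> L" for x using g(2)[of "int j + s * x"] by (simp add: algebra_simps)
    then have "segment ?h (2 * l + 1) \<in> (\<Union>a\<in>V. walks L l a a)"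
      by (rule segment_in_closed_walks[OF h l])
    moreover have "cycle_edges ((!) (segment ?h (2 * l + 1))) (2 * l) = edge_trace g"
      using l cycle_params_cyclic[OF h] by (simp add: cycle_edges_segment edge_trace_reparam[OF s])
    ultimately show "?walk p \<in> ?F" by (simp add: p)
  qed
  moreover have "inj_on ?walk ?D"
    using l by (intro inj_on_segment_reparam cycle_params_cyclic[OF g(1)]) auto
  moreover have "finite ?F" by (rule finite_subset[of _ "\<Union>a\<in>V. walks L l a a"]) (use finite_V in auto)
  ultimately have "card ?D \<le> card ?F" by (intro card_inj_on_le)
  then show ?thesis by (simp add: card_cartesian_product)
qed

lemma card_even_copies_le_card_walks:
  assumes l: "2 \<le> l"
  shows "2 * l * card (even_copies L l) \<le> card (\<Union>a\<in>V. walks L l a a)"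
proof -
  let ?U = "\<Union>a\<in>V. walks L l a a"
  let ?cycle = "\<lambda>xs. cycle_edges ((!) xs) (2 * l)"
  let ?A = "{xs \<in> ?U. ?cycle xs \<in> even_copies L l}"
  have finite_U: "finite ?U" using finite_V by simp
  have "2 * l * card (even_copies L l) \<le> card ?A"
  proof (rule mult_card_le_card_if_fibres_ge[of _ _ ?cycle])
    show "finite ?A" by (rule finite_subset[OF _ finite_U]) blast
    have "even_copies L l \<subseteq> cycle_copies (2 * l) E"
      using l by (auto simp: even_copies_def cycle_copies_eq)
    then show "finite (even_copies L l)" using finite_cycle_copies by (rule finite_subset)
    fix C assume C: "C \<in> even_copies L l"
    then have "2 * l \<le> card {xs \<in> ?U. ?cycle xs = C}"
      using card_closed_walks_of_cycle_ge[OF _ _ l] by (fastforce simp: even_copies_def)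
    also have "{xs \<in> ?U. ?cycle xs = C} = {xs \<in> ?A. ?cycle xs = C}" using C by blast
    finally show "2 * l \<le> card {xs \<in> ?A. ?cycle xs = C}" .
  qed auto
  also have "\<dots> \<le> card ?U" by (rule card_mono[OF finite_U]) blast
  finally show ?thesis .
qed

lemma card_even_copies_le:
  assumes l: "2 \<le> l" and R: "\<And>a. a \<in> L \<Longrightarrow> real (cherries a) \<le> R" "0 \<le> R"
  shows "real (2 * l * card (even_copies L l)) \<le> R ^ (l - 2) * real (\<Sum>a\<in>V. \<Sum>b\<in>V - {a}. (codeg a b)\<^sup>2)"
proof -
  interpret bounded_weights V "codeg_weight L" R by (rule bounded_weights_codeg_weight[OF R])
  have "real (2 * l * card (even_copies L l)) \<le> real (\<Sum>a\<in>V. card (walks L l a a))"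
    unfolding of_nat_le_iff
    using card_even_copies_le_card_walks[OF l] card_UN_le[OF finite_V] by (rule order_trans)
  also have "\<dots> \<le> (\<Sum>a\<in>V. walk_weight V (codeg_weight L) l a a)"
    by (simp add: sum_mono card_walks_le)
  also have "\<dots> \<le> R ^ (l - 2) * (\<Sum>a\<in>V. \<Sum>b\<in>V. (codeg_weight L a b)\<^sup>2)"
    using sum_closed_walk_weight_le[of "l - 2"] unfolding le_add_diff_inverse2[OF l] .
  also have "\<dots> \<le> R ^ (l - 2) * (\<Sum>a\<in>V. \<Sum>b\<in>V - {a}. (real (codeg a b))\<^sup>2)"
  proof (intro mult_left_mono sum_mono)
    fix a
    have "(\<Sum>b\<in>V. (codeg_weight L a b)\<^sup>2) = (\<Sum>b\<in>V - {a}. (codeg_weight L a b)\<^sup>2)"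
      using finite_V by (intro sum.mono_neutral_right) (auto simp: codeg_weight_def)
    also have "\<dots> \<le> (\<Sum>b\<in>V - {a}. (real (codeg a b))\<^sup>2)"
      by (intro sum_mono) (simp add: codeg_weight_def)
    finally show "(\<Sum>b\<in>V. (codeg_weight L a b)\<^sup>2) \<le> (\<Sum>b\<in>V - {a}. (real (codeg a b))\<^sup>2)" .
  qed (simp add: R(2))
  finally show ?thesis by simp
qed

definition walks_from :: "nat \<Rightarrow> 'a \<Rightarrow> 'a list set" where
  "walks_from j a = (\<Union>b\<in>V. walks V j a b)"

lemma finite_walks_from [simp]: "finite (walks_from j a)"
  by (simp add: walks_from_def finite_V)

lemma card_walks_from_le:
  assumes "\<And>a. real (cherries a) \<le> R" "0 \<le> R"
  shows "real (card (walks_from j a)) \<le> R ^ j"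
proof -
  interpret bounded_weights V "codeg_weight V" R by (intro bounded_weights_codeg_weight assms)
  have "real (card (walks_from j a)) \<le> real (\<Sum>b\<in>V. card (walks V j a b))"
    unfolding of_nat_le_iff walks_from_def by (rule card_UN_le[OF finite_V])
  also have "\<dots> \<le> (\<Sum>b\<in>V. walk_weight V (codeg_weight V) j a b)"
    by (simp add: sum_mono card_walks_le)
  also have "\<dots> \<le> R ^ j" by (rule sum_walk_weight_from_le)
  finally show ?thesis .
qed

lemma segment_in_walks_from:
  assumes "g \<in> cycle_params m E" "2 < m"
  shows "segment g (2 * j + 1) \<in> walks_from j (g 0)"
  unfolding walks_from_def
  using segment_in_walks[OF assms, of j V] cycle_params_in_V[OF assms(1)] by blast

definition copies_through :: "'a set \<Rightarrow> nat \<Rightarrow> nat \<Rightarrow> 'a set set set" where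
  "copies_through H l j = edge_trace ` {g \<in> cycle_params (2 * l) E. g 0 \<in> H \<and> g (2 * int j + 1) \<in> H}"

lemma copies_through_subset:
  assumes "2 \<le> l" "j < l"
  shows "copies_through H l j \<subseteq> (\<lambda>(x, y, us, vs). cycle_edges ((!) (us @ y # rev (tl vs))) (2 * l)) `
    (SIGMA x:H. H \<times> walks_from j x \<times> walks_from (l - 1 - j) x)"
    (is "_ \<subseteq> ?cycle ` ?D")
proof
  fix C assume "C \<in> copies_through H l j"
  then obtain g where g: "g \<in> cycle_params (2 * l) E" "g 0 \<in> H" "g (2 * int j + 1) \<in> H" "C = edge_trace g"
    by (auto simp: copies_through_def)
  let ?h = "\<lambda>x. g (- x)"
  let ?us = "segment g (2 * j + 1)" and ?vs = "segment ?h (2 * (l - 1 - j) + 1)"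
  have h: "?h \<in> cycle_params (2 * l) E" using cycle_params_reparam[OF g(1), of "-1" 0] by simp
  have "2 < 2 * l" using assms(1) by linarith
  then have "?us \<in> walks_from j (g 0)" "?vs \<in> walks_from (l - 1 - j) (g 0)"
    using segment_in_walks_from[OF g(1)] segment_in_walks_from[OF h] by simp_all
  then have in_D: "(g 0, g (2 * int j + 1), ?us, ?vs) \<in> ?D" using g(2,3) by blast
  have "2 * l - (2 * j + 1) = 2 * (l - 1 - j) + 1" using assms(2) by linarith
  then have "segment g (2 * l) = ?us @ g (2 * int j + 1) # rev (tl ?vs)"
    using segment_cyclic_split[OF cycle_params_cyclic[OF g(1)], of "2 * j + 1"] assms(2)
    by (simp add: add.commute)
  then have "C = ?cycle (g 0, g (2 * int j + 1), ?us, ?vs)"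
    using cycle_edges_segment[OF cycle_params_cyclic[OF g(1)], of "2 * l"] assms(1) g(4) by simp
  then show "C \<in> ?cycle ` ?D" using in_D by (rule image_eqI)
qed

lemma card_copies_through_le:
  assumes "2 \<le> l" "j < l" "finite H" and R: "\<And>a. real (cherries a) \<le> R" "0 \<le> R"
  shows "real (card (copies_through H l j)) \<le> (real (card H))\<^sup>2 * R ^ (l - 1)"
proof -
  let ?D = "SIGMA x:H. H \<times> walks_from j x \<times> walks_from (l - 1 - j) x"
  have "card (copies_through H l j) \<le> card ?D"
    using assms(3) by (intro surj_card_le[OF _ copies_through_subset[OF assms(1,2)]]) auto
  also have "\<dots> = (\<Sum>x\<in>H. card H * (card (walks_from j x) * card (walks_from (l - 1 - j) x)))"
    using assms(3) by (simp add: card_cartesian_product)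
  finally have "real (card (copies_through H l j)) \<le>
      (\<Sum>x\<in>H. real (card H) * (real (card (walks_from j x)) * real (card (walks_from (l - 1 - j) x))))"
    by (simp only: of_nat_le_iff flip: of_nat_mult of_nat_sum)
  also have "\<dots> \<le> (\<Sum>x\<in>H. real (card H) * (R ^ j * R ^ (l - 1 - j)))"
    using R(2) by (intro sum_mono mult_left_mono mult_mono card_walks_from_le[OF R]) auto
  also have "\<dots> = (real (card H))\<^sup>2 * R ^ (l - 1)"
    using assms(2) by (simp add: power2_eq_square flip: power_add)
  finally show ?thesis .
qed

lemma cycle_copies_subset:
  assumes "l > 0"
  shows "cycle_copies (2 * l) E \<subseteq> even_copies L l \<union> (\<Union>j<l. copies_through (V - L) l j)"
proof
  fix C assume "C \<in> cycle_copies (2 * l) E"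
  then obtain g where g: "g \<in> cycle_params (2 * l) E" "C = edge_trace g"
    using assms by (auto simp: cycle_copies_eq)
  have shift: "(\<lambda>x. g (c + x)) \<in> cycle_params (2 * l) E" "edge_trace (\<lambda>x. g (c + x)) = C" for c
    using cycle_params_reparam[OF g(1), of 1 c] edge_trace_reparam[of 1 g c] g(2) by simp_all
  consider (even) "\<forall>x. g (2 * x) \<in> L" | (odd) "\<forall>x. g (1 + 2 * x) \<in> L"
    | (both) a b where "g (2 * a) \<notin> L" "g (1 + 2 * b) \<notin> L" by blast
  then show "C \<in> even_copies L l \<union> (\<Union>j<l. copies_through (V - L) l j)"
  proof cases
    case even
    then show ?thesis using g by (auto simp: even_copies_def)
  next
    case odd
    then have "C \<in> even_copies L l"
      unfolding even_copies_def using shift[of 1] by (intro image_eqI[of _ _ "\<lambda>x. g (1 + x)"]) auto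
    then show ?thesis ..
  next
    case (both a b)
    define j where "j = nat ((b - a) mod int l)"
    have j: "j < l" "int j = (b - a) mod int l" using assms by (simp_all add: j_def nat_less_iff)
    have "int l dvd int j - (b - a)" unfolding j(2) mod_eq_dvd_iff[symmetric] by simp
    then have "int (2 * l) dvd 2 * (int j - (b - a))"
      unfolding of_nat_mult of_nat_numeral by (rule mult_dvd_mono[OF dvd_refl])
    also have "2 * (int j - (b - a)) = 2 * a + (2 * int j + 1) - (1 + 2 * b)" by simp
    finally have "g (2 * a + (2 * int j + 1)) = g (1 + 2 * b)"
      using cyclic_eq_iff[OF cycle_params_cyclic[OF g(1)]] by blast
    then have "C \<in> copies_through (V - L) l j"
      unfolding copies_through_def using both shift[of "2 * a"] cycle_params_in_V[OF g(1)]
      by (intro image_eqI[of _ _ "\<lambda>x. g (2 * a + x)"]) auto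
    then show ?thesis using j(1) by blast
  qed
qed

end

subsection \<open>Heavy vertices\<close>

lemma (in finite_graph) sum_degree_square:
  "(\<Sum>w\<in>V. (card (nb w))\<^sup>2) = (\<Sum>a\<in>V. card (nb a) + cherries a)"
proof -
  have codeg: "codeg a b = (\<Sum>w\<in>V. of_bool (adj w a) * of_bool (adj w b))" for a b
  proof -
    have "common_nb a b = V \<inter> {w. adj w a \<and> adj w b}"
      using adj_in_V by (auto simp: adj_commute)
    then show ?thesis using finite_V by (simp add: codeg_def flip: of_bool_conj)
  qed
  have degree: "card (nb w) = (\<Sum>a\<in>V. of_bool (adj w a))" for w
  proof -
    have "nb w = V \<inter> {a. adj w a}" using adj_in_V by auto
    then show ?thesis using finite_V by simp
  qed
  have "(\<Sum>w\<in>V. (card (nb w))\<^sup>2) = (\<Sum>w\<in>V. \<Sum>a\<in>V. \<Sum>b\<in>V. of_bool (adj w a) * of_bool (adj w b))"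
    by (simp only: degree power2_eq_square sum_product)
  also have "\<dots> = (\<Sum>a\<in>V. \<Sum>w\<in>V. \<Sum>b\<in>V. of_bool (adj w a) * of_bool (adj w b))"
    by (rule sum.swap)
  also have "\<dots> = (\<Sum>a\<in>V. \<Sum>b\<in>V. codeg a b)"
    unfolding codeg by (intro sum.cong refl sum.swap)
  also have "\<dots> = (\<Sum>a\<in>V. card (nb a) + cherries a)"
    using finite_V by (intro sum.cong refl) (simp add: cherries_def sum.remove codeg_self)
  finally show ?thesis .
qed

definition cherry_coeff :: "nat \<Rightarrow> real \<Rightarrow> real" where
  "cherry_coeff k \<delta> = real (k - 1) + 2 * real k * \<delta>"

definition heavy_bound :: "nat \<Rightarrow> real \<Rightarrow> real" where
  "heavy_bound k \<delta> = 4 * real k / \<delta>\<^sup>2"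

definition thin_coeff :: "nat \<Rightarrow> real" where
  "thin_coeff k = (2 * real k)\<^sup>2 * (1 + (real k)\<^sup>2)"

text \<open>With \<open>R = cherry_coeff k \<delta> * n\<close>, these are the coefficients of \<open>n ^ l\<close> and \<open>n ^ (l - 1)\<close> in the
  bound on \<open>R ^ (l - 2) * S\<close> plus the contribution of the cycles with heavy vertices in both classes.\<close>

definition main_coeff :: "nat \<Rightarrow> nat \<Rightarrow> real \<Rightarrow> real" where
  "main_coeff k l \<delta> =
     cherry_coeff k \<delta> ^ (l - 2) * (real (2 * k - 3) * cherry_coeff k \<delta> + thin_coeff k * \<delta>)"

definition error_coeff :: "nat \<Rightarrow> nat \<Rightarrow> real \<Rightarrow> real" where
  "error_coeff k l \<delta> =
     cherry_coeff k \<delta> ^ (l - 2) * (heavy_bound k \<delta> * (real (2 * k - 3) * (3 * real k) + thin_coeff k))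
     + 2 * real l * (real l * ((heavy_bound k \<delta>)\<^sup>2 * (3 * real k) ^ (l - 1)))"

lemma cherry_coeff_nonneg: "0 \<le> \<delta> \<Longrightarrow> 0 \<le> cherry_coeff k \<delta>"
  by (simp add: cherry_coeff_def)

lemma heavy_bound_nonneg: "0 \<le> heavy_bound k \<delta>"
  by (simp add: heavy_bound_def)

lemma thin_coeff_nonneg: "0 \<le> thin_coeff k"
  by (simp add: thin_coeff_def)

context even_cycle_free
begin

definition light :: "real \<Rightarrow> 'a set" where
  "light \<delta> = {v \<in> V. real (card (nb v)) \<le> \<delta> * real (card V)}"

lemma cherries_le_uniform: "real (cherries v) \<le> 3 * real k * real (card V)"
proof -
  have "cherries v \<le> (k - 1) * card V + 2 * k * card V"
    using cherries_le[of v] card_nb_le[of v] by (meson add_left_mono le_trans mult_le_mono2)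
  also have "\<dots> \<le> k * card V + 2 * k * card V" by simp
  also have "\<dots> = 3 * k * card V" by simp
  finally have "real (cherries v) \<le> real (3 * k * card V)" by (simp only: of_nat_le_iff)
  then show ?thesis by simp
qed

lemma cherries_light_le:
  assumes "v \<in> light \<delta>"
  shows "real (cherries v) \<le> cherry_coeff k \<delta> * real (card V)"
proof -
  have "real (cherries v) \<le> real ((k - 1) * card V + 2 * k * card (nb v))"
    by (simp only: of_nat_le_iff cherries_le)
  also have "\<dots> \<le> real (k - 1) * real (card V) + 2 * real k * (\<delta> * real (card V))"
    using assms by (simp add: light_def mult_left_mono)
  finally show ?thesis by (simp add: cherry_coeff_def algebra_simps)
qed

lemma sum_degree_square_le: "real (\<Sum>w\<in>V. (card (nb w))\<^sup>2) \<le> 4 * real k * (real (card V))\<^sup>2"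
proof -
  have "real (card (nb a)) + real (cherries a) \<le> 4 * real k * real (card V)" for a
  proof -
    have "real (card (nb a)) \<le> real (card V)" using card_nb_le by simp
    also have "\<dots> \<le> real k * real (card V)" using k_ge_2 by (simp add: mult_le_cancel_right1)
    finally show ?thesis using cherries_le_uniform[of a] by simp
  qed
  then have "(\<Sum>a\<in>V. real (card (nb a)) + real (cherries a)) \<le> (\<Sum>a\<in>V. 4 * real k * real (card V))"
    by (rule sum_mono)
  then show ?thesis by (simp only: sum_degree_square) (simp add: power2_eq_square mult_ac)
qed

lemma card_heavy_le:
  assumes "\<delta> > 0"
  shows "real (card (V - light \<delta>)) \<le> heavy_bound k \<delta>"
proof (cases "card V = 0")
  case True
  then show ?thesis using finite_V heavy_bound_nonneg by simp
next
  case False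
  have "real (card (V - light \<delta>)) * (\<delta> * real (card V))\<^sup>2 \<le> (\<Sum>w\<in>V - light \<delta>. (real (card (nb w)))\<^sup>2)"
    using assms by (intro sum_bounded_below power_mono) (auto simp: light_def)
  also have "\<dots> \<le> (\<Sum>w\<in>V. (real (card (nb w)))\<^sup>2)"
    using finite_V by (intro sum_mono2) auto
  also have "\<dots> \<le> 4 * real k * (real (card V))\<^sup>2"
    using sum_degree_square_le by simp
  finally show ?thesis
    using False assms by (simp add: heavy_bound_def power_mult_distrib pos_le_divide_eq mult_ac)
qed

lemma sum_light_heavy_le:
  fixes f :: "'a \<Rightarrow> real"
  assumes "\<delta> > 0" and "\<And>v. v \<in> light \<delta> \<Longrightarrow> f v \<le> B" "0 \<le> B" and "\<And>v. f v \<le> B'" "0 \<le> B'"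
  shows "(\<Sum>v\<in>V. f v) \<le> real (card V) * B + heavy_bound k \<delta> * B'"
proof -
  have light_subset: "light \<delta> \<subseteq> V" by (auto simp: light_def)
  have "(\<Sum>v\<in>V. f v) = (\<Sum>v\<in>V - light \<delta>. f v) + (\<Sum>v\<in>light \<delta>. f v)"
    by (rule sum.subset_diff[OF light_subset finite_V])
  also have "\<dots> \<le> real (card (V - light \<delta>)) * B' + real (card (light \<delta>)) * B"
    by (intro add_mono sum_bounded_above assms)
  also have "\<dots> \<le> heavy_bound k \<delta> * B' + real (card V) * B"
    using card_heavy_le[OF assms(1)] card_mono[OF finite_V light_subset] assms(3,5)
    by (intro add_mono mult_right_mono) simp_all
  finally show ?thesis by simp
qed

lemma sum_codeg_square_real_le:
  fixes \<delta> :: real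
  defines "n \<equiv> real (card V)"
  assumes "\<delta> > 0"
  shows "real (\<Sum>a\<in>V. \<Sum>b\<in>V - {a}. (codeg a b)\<^sup>2) \<le>
    (real (2 * k - 3) * cherry_coeff k \<delta> + thin_coeff k * \<delta>) * n\<^sup>2
    + heavy_bound k \<delta> * (real (2 * k - 3) * (3 * real k) + thin_coeff k) * n"
proof -
  have n: "0 \<le> n" by (simp add: n_def)
  have "(\<Sum>a\<in>V. real (cherries a)) \<le> n * (cherry_coeff k \<delta> * n) + heavy_bound k \<delta> * (3 * real k * n)"
    using assms(2) n unfolding n_def
    by (intro sum_light_heavy_le cherries_light_le cherries_le_uniform) (auto simp: cherry_coeff_nonneg)
  moreover have "(\<Sum>b\<in>V. real (card (nb b))) \<le> n * (\<delta> * n) + heavy_bound k \<delta> * n"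
    using assms(2) n unfolding n_def
    by (intro sum_light_heavy_le) (auto simp: light_def card_nb_le)
  moreover have "real (\<Sum>a\<in>V. \<Sum>b\<in>V - {a}. (codeg a b)\<^sup>2) \<le>
      real (2 * k - 3) * (\<Sum>a\<in>V. real (cherries a)) + thin_coeff k * (\<Sum>b\<in>V. real (card (nb b)))"
    using of_nat_mono[OF sum_codeg_square_le, where 'a = real]
    unfolding thin_coeff_def of_nat_add of_nat_mult of_nat_power of_nat_sum of_nat_numeral of_nat_1 .
  ultimately have "real (\<Sum>a\<in>V. \<Sum>b\<in>V - {a}. (codeg a b)\<^sup>2) \<le>
      real (2 * k - 3) * (n * (cherry_coeff k \<delta> * n) + heavy_bound k \<delta> * (3 * real k * n))
      + thin_coeff k * (n * (\<delta> * n) + heavy_bound k \<delta> * n)"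
    by (meson add_mono mult_left_mono of_nat_0_le_iff order_trans thin_coeff_nonneg)
  then show ?thesis by (simp add: power2_eq_square algebra_simps)
qed

lemma card_even_copies_light_le:
  fixes \<delta> :: real
  defines "n \<equiv> real (card V)"
  assumes l: "2 \<le> l" and \<delta>: "\<delta> > 0"
  shows "real (2 * l * card (even_copies (light \<delta>) l)) \<le> main_coeff k l \<delta> * n ^ l
    + cherry_coeff k \<delta> ^ (l - 2) * (heavy_bound k \<delta> * (real (2 * k - 3) * (3 * real k) + thin_coeff k)) * n ^ (l - 1)"
proof -
  obtain m where "l = 2 + m" using le_Suc_ex[OF l] by blast
  then have n_powers: "n ^ l = n ^ (l - 2) * n\<^sup>2" "n ^ (l - 1) = n ^ (l - 2) * n"
    by (simp_all add: power2_eq_square)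
  have R: "0 \<le> cherry_coeff k \<delta> * n" using \<delta> by (simp add: cherry_coeff_nonneg n_def)
  have "real (2 * l * card (even_copies (light \<delta>) l)) \<le>
      (cherry_coeff k \<delta> * n) ^ (l - 2) * real (\<Sum>a\<in>V. \<Sum>b\<in>V - {a}. (codeg a b)\<^sup>2)"
    using l cherries_light_le R unfolding n_def by (intro card_even_copies_le)
  also have "\<dots> \<le> (cherry_coeff k \<delta> * n) ^ (l - 2) *
      ((real (2 * k - 3) * cherry_coeff k \<delta> + thin_coeff k * \<delta>) * n\<^sup>2
       + heavy_bound k \<delta> * (real (2 * k - 3) * (3 * real k) + thin_coeff k) * n)"
    using R \<delta> unfolding n_def by (intro mult_left_mono sum_codeg_square_real_le) simp_all
  finally show ?thesis
    unfolding main_coeff_def n_powers by (simp add: algebra_simps)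
qed

lemma card_copies_through_heavy_le:
  fixes \<delta> :: real
  assumes "2 \<le> l" "j < l" "\<delta> > 0"
  shows "real (card (copies_through (V - light \<delta>) l j)) \<le>
    (heavy_bound k \<delta>)\<^sup>2 * (3 * real k) ^ (l - 1) * real (card V) ^ (l - 1)"
proof -
  have "real (card (copies_through (V - light \<delta>) l j)) \<le>
      (real (card (V - light \<delta>)))\<^sup>2 * (3 * real k * real (card V)) ^ (l - 1)"
    using assms(1,2) finite_V by (intro card_copies_through_le cherries_le_uniform) auto
  also have "\<dots> \<le> (heavy_bound k \<delta>)\<^sup>2 * (3 * real k * real (card V)) ^ (l - 1)"
    using card_heavy_le[OF assms(3)] by (intro mult_right_mono power_mono) auto
  finally show ?thesis by (simp add: power_mult_distrib mult_ac)
qed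

theorem card_cycle_copies_le:
  fixes \<delta> :: real
  defines "n \<equiv> real (card V)"
  assumes l: "2 \<le> l" and \<delta>: "\<delta> > 0"
  shows "2 * real l * real (card (cycle_copies (2 * l) E)) \<le>
    main_coeff k l \<delta> * n ^ l + error_coeff k l \<delta> * n ^ (l - 1)"
proof -
  let ?even = "even_copies (light \<delta>) l" and ?through = "copies_through (V - light \<delta>) l"
  let ?r = "(heavy_bound k \<delta>)\<^sup>2 * (3 * real k) ^ (l - 1)"
  have "?even \<union> (\<Union>j<l. ?through j) \<subseteq> cycle_copies (2 * l) E"
    using l by (auto simp: even_copies_def copies_through_def cycle_copies_eq)
  then have "finite (?even \<union> (\<Union>j<l. ?through j))" using finite_cycle_copies by (rule finite_subset)
  moreover have "cycle_copies (2 * l) E \<subseteq> ?even \<union> (\<Union>j<l. ?through j)"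
    using l by (intro cycle_copies_subset) simp
  ultimately have "card (cycle_copies (2 * l) E) \<le> card (?even \<union> (\<Union>j<l. ?through j))"
    by (rule card_mono)
  also have "\<dots> \<le> card ?even + (\<Sum>j<l. card (?through j))"
    by (intro order_trans[OF card_Un_le] add_left_mono card_UN_le) simp
  finally have "real (card (cycle_copies (2 * l) E)) \<le> real (card ?even) + (\<Sum>j<l. real (card (?through j)))"
    by (simp only: of_nat_le_iff flip: of_nat_add of_nat_sum)
  also have "(\<Sum>j<l. real (card (?through j))) \<le> (\<Sum>j<l. ?r * n ^ (l - 1))"
    using l \<delta> unfolding n_def by (intro sum_mono card_copies_through_heavy_le) simp_all
  finally have "real (card (cycle_copies (2 * l) E)) \<le> real (card ?even) + real l * (?r * n ^ (l - 1))"
    by simp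
  then have "2 * real l * real (card (cycle_copies (2 * l) E)) \<le>
      2 * real l * (real (card ?even) + real l * (?r * n ^ (l - 1)))"
    by (rule mult_left_mono) simp
  also have "\<dots> = real (2 * l * card ?even) + 2 * real l * (real l * (?r * n ^ (l - 1)))"
    by (simp add: algebra_simps)
  finally show ?thesis
    using card_even_copies_light_le[OF l \<delta>] by (simp add: error_coeff_def n_def algebra_simps)
qed

end

subsection \<open>The upper bound\<close>

lemma finite_graph_iff_simple_graph: "finite_graph {..<n} E \<longleftrightarrow> simple_graph n E"
  by (simp add: finite_graph_def simple_graph_def)

lemma finite_cycle_copies_simple_graph: "simple_graph n E \<Longrightarrow> finite (cycle_copies m E)"
  by (rule finite_graph.finite_cycle_copies[of "{..<n}"]) (simp add: finite_graph_iff_simple_graph)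

lemma finite_ex_cyc_set: "finite {card (cycle_copies (2 * l) E) | E. simple_graph n E \<and> cycle_copies (2 * k) E = {}}"
proof -
  have "{E. simple_graph n E} \<subseteq> Pow (Pow {..<n})" by (fastforce simp: simple_graph_def)
  then have "finite {E. simple_graph n E}" by (rule finite_subset) simp
  then show ?thesis by (rule finite_surj[of _ _ "\<lambda>E. card (cycle_copies (2 * l) E)"]) auto
qed

lemma card_cycle_copies_le_ex_cyc:
  assumes "simple_graph n E" "cycle_copies (2 * k) E = {}"
  shows "card (cycle_copies (2 * l) E) \<le> ex_cyc n l k"
  unfolding ex_cyc_def using assms by (intro Max_ge finite_ex_cyc_set) blast

lemma ex_cyc_attained:
  assumes "k > 0"
  obtains E where "simple_graph n E" "cycle_copies (2 * k) E = {}" "ex_cyc n l k = card (cycle_copies (2 * l) E)"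
proof -
  let ?S = "{card (cycle_copies (2 * l) E) | E. simple_graph n E \<and> cycle_copies (2 * k) E = {}}"
  have "simple_graph n {}" "cycle_copies (2 * k) ({} :: nat set set) = {}"
    using assms by (auto simp: simple_graph_def cycle_copies_def cycle_edges_def lessThan_empty_iff)
  then have "?S \<noteq> {}" by blast
  then have "Max ?S \<in> ?S" by (intro Max_in finite_ex_cyc_set)
  then show ?thesis using that unfolding ex_cyc_def by blast
qed

lemma ex_cyc_le:
  assumes "2 \<le> k" "2 \<le> l" "\<delta> > 0"
  shows "2 * real l * real (ex_cyc n l k) \<le> main_coeff k l \<delta> * real n ^ l + error_coeff k l \<delta> * real n ^ (l - 1)"
proof -
  obtain E where E: "simple_graph n E" "cycle_copies (2 * k) E = {}" "ex_cyc n l k = card (cycle_copies (2 * l) E)"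
    using ex_cyc_attained[of k n l] assms(1) by auto
  interpret finite_graph "{..<n}" E using E(1) by (simp add: finite_graph_iff_simple_graph)
  interpret even_cycle_free "{..<n}" E k by unfold_locales (rule assms(1) E(2))+
  show ?thesis using card_cycle_copies_le[OF assms(2,3)] by (simp add: E(3))
qed

lemma ex_main_coeff_less:
  assumes "2 \<le> k" "2 \<le> l"
  shows "\<exists>\<delta>>0. main_coeff k l \<delta> < 2 * real (k - 1) ^ l"
proof -
  let ?lim = "real (k - 1) ^ (l - 2) * (real (2 * k - 3) * real (k - 1))"
  have "cherry_coeff k \<midarrow>0\<rightarrow> real (k - 1) + 2 * real k * 0"
    unfolding cherry_coeff_def by (intro tendsto_intros)
  then have "main_coeff k l \<midarrow>0\<rightarrow> (real (k - 1) + 2 * real k * 0) ^ (l - 2) *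
      (real (2 * k - 3) * (real (k - 1) + 2 * real k * 0) + thin_coeff k * 0)"
    unfolding main_coeff_def by (intro tendsto_intros)
  then have lim: "(main_coeff k l \<longlongrightarrow> ?lim) (at_right 0)"
    by (simp add: filterlim_at_split)
  have "real (2 * k - 3) * real (k - 1) < 2 * (real (k - 1))\<^sup>2"
    using assms(1) by (simp add: power2_eq_square)
  then have "?lim < real (k - 1) ^ (l - 2) * (2 * (real (k - 1))\<^sup>2)"
    using assms(1) by (intro mult_strict_left_mono) simp_all
  also have "\<dots> = 2 * (real (k - 1) ^ (l - 2 + 2))" by (simp only: power_add mult_ac)
  also have "\<dots> = 2 * real (k - 1) ^ l" by (simp only: le_add_diff_inverse2[OF assms(2)])
  finally have "\<forall>\<^sub>F \<delta> in at_right 0. main_coeff k l \<delta> < 2 * real (k - 1) ^ l"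
    by (rule order_tendstoD(2)[OF lim])
  then have "\<forall>\<^sub>F \<delta> in at_right 0. \<delta> > 0 \<and> main_coeff k l \<delta> < 2 * real (k - 1) ^ l"
    using eventually_at_right_less by (rule eventually_conj[rotated])
  then show ?thesis using eventually_happens'[OF trivial_limit_at_right_real] by blast
qed

lemma eventually_lower_order_le:
  fixes c d :: real
  assumes "d > 0" "l > 0"
  shows "\<forall>\<^sub>F n in sequentially. c * real n ^ (l - 1) \<le> d * real n ^ l"
proof -
  have "\<forall>\<^sub>F n in sequentially. c / d \<le> real n"
    using filterlim_real_sequentially by (simp add: filterlim_at_top)
  then show ?thesis
  proof eventually_elim
    case (elim n)
    then have "c \<le> d * real n" using assms(1) by (simp add: pos_divide_le_eq mult.commute)
    then have "c * real n ^ (l - 1) \<le> d * real n * real n ^ (l - 1)" by (rule mult_right_mono) simp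
    also have "\<dots> = d * real n ^ l" using assms(2) by (simp add: power_eq_if)
    finally show ?case .
  qed
qed

theorem eventually_ex_cyc_le:
  assumes k: "2 \<le> k" and l: "2 \<le> l"
  shows "\<forall>\<^sub>F n in sequentially. real (ex_cyc n l k) \<le> real (k - 1) ^ l / real l * real n ^ l"
proof -
  obtain \<delta> where \<delta>: "\<delta> > 0" "main_coeff k l \<delta> < 2 * real (k - 1) ^ l"
    using ex_main_coeff_less[OF k l] by blast
  have "\<forall>\<^sub>F n in sequentially. error_coeff k l \<delta> * real n ^ (l - 1) \<le>
      (2 * real (k - 1) ^ l - main_coeff k l \<delta>) * real n ^ l"
    using \<delta>(2) l by (intro eventually_lower_order_le) simp_all
  then show ?thesis
  proof eventually_elim
    case (elim n)
    then have "2 * real l * real (ex_cyc n l k) \<le> 2 * real (k - 1) ^ l * real n ^ l"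
      using ex_cyc_le[OF k l \<delta>(1), of n] by (simp add: algebra_simps)
    then show ?case using l by (simp add: field_simps)
  qed
qed

subsection \<open>Constructions of cycles\<close>

lemma nth_splice:
  assumes "length xs = length ys" "i < length xs"
  shows "splice xs ys ! (2 * i) = xs ! i" "splice xs ys ! (2 * i + 1) = ys ! i"
proof -
  have "i < length xs \<longrightarrow> splice xs ys ! (2 * i) = xs ! i \<and> splice xs ys ! (2 * i + 1) = ys ! i"
    using assms(1)
  proof (induction xs ys arbitrary: i rule: list_induct2)
    case (Cons x xs y ys)
    then show ?case by (cases i) auto
  qed simp
  then show "splice xs ys ! (2 * i) = xs ! i" "splice xs ys ! (2 * i + 1) = ys ! i"
    using assms(2) by auto
qed

lemma splice_eq_imp_eq:
  assumes "splice xs ys = splice xs' ys'"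
    and "length xs = l" "length ys = l" "length xs' = l" "length ys' = l"
  shows "xs = xs' \<and> ys = ys'"
  using assms by (metis nth_equalityI nth_splice)

lemma cycle_edges_splice:
  assumes "length xs = l" "length ys = l"
  shows "cycle_edges ((!) (splice xs ys)) (2 * l) = (\<Union>i<l. {{xs ! i, ys ! i}, {ys ! i, xs ! (Suc i mod l)}})"
proof -
  have even_step: "Suc (2 * i) mod (2 * l) = 2 * i + 1" if "i < l" for i
    using that by simp
  have odd_step: "Suc (2 * i + 1) mod (2 * l) = 2 * (Suc i mod l)" for i
    by (simp add: mult_mod_right)
  have "{..<2 * l} = (\<Union>i<l. {2 * i, 2 * i + 1})"
  proof (intro equalityI subsetI)
    fix i assume "i \<in> {..<2 * l}"
    then have "i div 2 < l" "i \<in> {2 * (i div 2), 2 * (i div 2) + 1}" by auto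
    then show "i \<in> (\<Union>i<l. {2 * i, 2 * i + 1})" by blast
  qed auto
  then have "cycle_edges ((!) (splice xs ys)) (2 * l) =
      (\<Union>i<l. (\<lambda>i. {splice xs ys ! i, splice xs ys ! (Suc i mod (2 * l))}) ` {2 * i, 2 * i + 1})"
    by (simp only: cycle_edges_def image_UN)
  also have "\<dots> = (\<Union>i<l. {{xs ! i, ys ! i}, {ys ! i, xs ! (Suc i mod l)}})"
  proof (intro SUP_cong refl)
    fix i assume "i \<in> {..<l}"
    then have "i < l" "Suc i mod l < l" by auto
    then show "(\<lambda>i. {splice xs ys ! i, splice xs ys ! (Suc i mod (2 * l))}) ` {2 * i, 2 * i + 1} =
        {{xs ! i, ys ! i}, {ys ! i, xs ! (Suc i mod l)}}"
      using assms by (simp only: image_insert image_empty even_step odd_step nth_splice)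
  qed
  finally show ?thesis .
qed

lemma splice_in_cycle_copies:
  assumes "distinct xs" "distinct ys" "set xs \<inter> set ys = {}" "length xs = l" "length ys = l"
    and "\<And>i. i < l \<Longrightarrow> {xs ! i, ys ! i} \<in> E" "\<And>i. i < l \<Longrightarrow> {ys ! i, xs ! (Suc i mod l)} \<in> E"
  shows "cycle_edges ((!) (splice xs ys)) (2 * l) \<in> cycle_copies (2 * l) E"
proof -
  have "inj_on ((!) (splice xs ys)) {..<2 * l}"
    using assms(1-5) by (intro inj_on_nth distinct_splice) auto
  moreover have "cycle_edges ((!) (splice xs ys)) (2 * l) \<subseteq> E"
    using assms(4-7) by (auto simp: cycle_edges_splice)
  ultimately show ?thesis by (auto simp: cycle_copies_def)
qed

lemma list_eq_if_cycle_edges_eq: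
  assumes "distinct xs" "distinct ys" "length xs = m" "length ys = m" "3 \<le> m"
    and "cycle_edges ((!) xs) m = cycle_edges ((!) ys) m" "xs ! 0 = ys ! 0" "xs ! 1 = ys ! 1"
  shows "xs = ys"
proof -
  have "\<exists>g. cyclic m g \<and> (\<forall>i<m. g (int i) = zs ! i)" if "distinct zs" "length zs = m" for zs :: "'a list"
    using that assms(5) by (intro ex_cyclic_extension inj_on_nth) auto
  then obtain g h where g: "cyclic m g" "\<And>i. i < m \<Longrightarrow> g (int i) = xs ! i"
    and h: "cyclic m h" "\<And>i. i < m \<Longrightarrow> h (int i) = ys ! i"
    using assms(1-4) by metis
  have "edge_trace g = cycle_edges ((!) xs) m" "edge_trace h = cycle_edges ((!) ys) m"
    using assms(5) g h by (auto simp flip: cycle_edges_cyclic intro!: cycle_edges_cong)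
  then have trace: "edge_trace g = edge_trace h" using assms(6) by simp
  have "g 0 = h 0" "g 1 = h 1"
    using g(2)[of 0] g(2)[of 1] h(2)[of 0] h(2)[of 1] assms(5,7,8) by simp_all
  then have "g (int i) = h (int i)" for i
    by (rule cyclic_eq_if_edge_trace_eq[OF g(1) h(1) assms(5) trace])
  then show ?thesis using g(2) h(2) assms(3,4) by (intro nth_equalityI) auto
qed

lemma card_cycle_edges_le: "card (cycle_edges f m) \<le> m"
  unfolding cycle_edges_def using card_image_le[of "{..<m}"] by simp

lemma finite_cycle_edges: "finite (cycle_edges f m)"
  by (simp add: cycle_edges_def)

lemma Union_cycle_edges: "\<Union> (cycle_edges f m) = f ` {..<m}"
proof -
  have "f (Suc i mod m) \<in> f ` {..<m}" if "i < m" for i using that by (intro imageI) auto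
  then show ?thesis by (auto simp: cycle_edges_def)
qed

lemma ex_bipartite_cycle_param:
  assumes "\<And>x y. {x, y} \<in> E \<Longrightarrow> P x \<longleftrightarrow> \<not> P y" "cycle_copies m E \<noteq> {}" "m > 0"
  shows "\<exists>g\<in>cycle_params m E. \<forall>i. P (g (2 * int i))"
proof -
  obtain g where g: "g \<in> cycle_params m E" using assms(2,3) by (auto simp: cycle_copies_eq)
  have flip: "P (g (x + 1)) \<longleftrightarrow> \<not> P (g x)" for x
    using assms(1)[OF cycle_params_edge[OF g, of x]] by blast
  have double_step: "P (g (c + 2 * int i)) \<longleftrightarrow> P (g c)" for c i
  proof (induction i)
    case (Suc i)
    have "c + 2 * int (Suc i) = (c + 2 * int i + 1) + 1" by simp
    then show ?case using Suc flip by metis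
  qed simp
  obtain c where "P (g c)" using flip by blast
  then show ?thesis
    using double_step cycle_params_reparam[OF g, of 1 c] by (intro bexI[of _ "\<lambda>x. g (c + x)"]) auto
qed

definition distinct_lists :: "nat \<Rightarrow> 'a set \<Rightarrow> 'a list set" where
  "distinct_lists l A = {xs. length xs = l \<and> distinct xs \<and> set xs \<subseteq> A}"

lemma finite_distinct_lists: "finite A \<Longrightarrow> finite (distinct_lists l A)"
  by (rule finite_subset[OF _ finite_lists_length_eq[of A l]]) (auto simp: distinct_lists_def)

lemma card_splices_of_cycle_le:
  assumes "2 \<le> l" "A \<inter> B = {}"
  shows "card {p \<in> distinct_lists l A \<times> distinct_lists l B.
    (\<lambda>(xs, ys). cycle_edges ((!) (splice xs ys)) (2 * l)) p = C} \<le> 2 * l" (is "card ?F \<le> _")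
proof (cases "?F = {}")
  case False
  then have C: "finite C" "card C \<le> 2 * l" by (auto simp: finite_cycle_edges card_cycle_edges_le)
  let ?first_edge = "\<lambda>(xs, ys). {xs ! 0, ys ! 0}"
  have inj: "inj_on ?first_edge ?F"
  proof (rule inj_onI)
    fix p q assume in_F: "p \<in> ?F" "q \<in> ?F" and first: "?first_edge p = ?first_edge q"
    obtain xs ys xs' ys' where p: "p = (xs, ys)" "q = (xs', ys')" by (metis surj_pair)
    have lists: "length xs = l" "length ys = l" "length xs' = l" "length ys' = l" "distinct xs" "distinct ys"
      "distinct xs'" "distinct ys'" "set xs \<subseteq> A" "set xs' \<subseteq> A" "set ys \<subseteq> B" "set ys' \<subseteq> B"
      and cycle: "cycle_edges ((!) (splice xs ys)) (2 * l) = cycle_edges ((!) (splice xs' ys')) (2 * l)"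
      using in_F by (auto simp: p distinct_lists_def)
    have "xs ! 0 \<in> A" "xs' ! 0 \<in> A" "ys ! 0 \<in> B" "ys' ! 0 \<in> B"
      using lists assms(1) nth_mem by (metis less_le_trans pos2 subsetD)+
    then have "xs ! 0 = xs' ! 0" "ys ! 0 = ys' ! 0"
      using first assms(2) by (auto simp: p doubleton_eq_iff)
    then have "splice xs ys ! 0 = splice xs' ys' ! 0" "splice xs ys ! 1 = splice xs' ys' ! 1"
      using lists assms(1) nth_splice[of xs ys 0] nth_splice[of xs' ys' 0] by simp_all
    moreover have "set xs \<inter> set ys = {}" "set xs' \<inter> set ys' = {}" using lists assms(2) by blast+
    ultimately have "splice xs ys = splice xs' ys'"
      using lists assms(1) cycle by (intro list_eq_if_cycle_edges_eq[of _ _ "2 * l"] distinct_splice) simp_all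
    then show "p = q" using splice_eq_imp_eq lists p by metis
  qed
  have "?first_edge p \<in> C" if "p \<in> ?F" for p
    using that assms(1) by (fastforce simp: cycle_edges_splice distinct_lists_def)
  then have "card ?F \<le> card C" by (intro card_inj_on_le[OF inj _ C(1)]) blast
  then show ?thesis using C(2) by (rule order_trans)
qed (simp only: card.empty)

subsection \<open>Complete bipartite graphs\<close>

definition complete_bipartite :: "nat \<Rightarrow> nat \<Rightarrow> nat set set" where
  "complete_bipartite s n = {{u, v} | u v. u < s \<and> s \<le> v \<and> v < n}"

lemma in_complete_bipartite_iff:
  "{x, y} \<in> complete_bipartite s n \<longleftrightarrow> (x < s \<and> s \<le> y \<and> y < n) \<or> (y < s \<and> s \<le> x \<and> x < n)"
  unfolding complete_bipartite_def by (auto simp: doubleton_eq_iff)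

lemma simple_graph_complete_bipartite: "simple_graph n (complete_bipartite s n)"
  unfolding simple_graph_def complete_bipartite_def by fastforce

lemma cycle_copies_complete_bipartite_empty:
  assumes "s < k"
  shows "cycle_copies (2 * k) (complete_bipartite s n) = {}"
proof (rule ccontr)
  assume "cycle_copies (2 * k) (complete_bipartite s n) \<noteq> {}"
  then have "\<exists>g\<in>cycle_params (2 * k) (complete_bipartite s n). \<forall>i. g (2 * int i) < s"
    using assms by (intro ex_bipartite_cycle_param) (auto simp: in_complete_bipartite_iff)
  then obtain g where g: "g \<in> cycle_params (2 * k) (complete_bipartite s n)" "\<And>i. g (2 * int i) < s"
    by blast
  have "inj_on (\<lambda>i. g (2 * int i)) {..<k}"
  proof (rule inj_onI)
    fix i j assume ij: "i \<in> {..<k}" "j \<in> {..<k}" "g (2 * int i) = g (2 * int j)"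
    then have "int (2 * k) dvd 2 * int i - 2 * int j"
      by (simp only: cyclic_eq_iff[OF cycle_params_cyclic[OF g(1)]])
    then have "(2 * int i) mod int (2 * k) = (2 * int j) mod int (2 * k)"
      by (simp only: mod_eq_dvd_iff)
    then show "i = j" using ij(1,2) by simp
  qed
  then have "card {..<k} \<le> card {..<s}" by (rule card_inj_on_le) (use g(2) in auto)
  then show False using assms by simp
qed

lemma card_cycle_copies_complete_bipartite_ge:
  assumes "2 \<le> l" "l \<le> s" "l \<le> n - s"
  shows "\<Prod>{n - s - l + 1..n - s} * \<Prod>{s - l + 1..s} \<le>
    2 * l * card (cycle_copies (2 * l) (complete_bipartite s n))"
proof -
  let ?E = "complete_bipartite s n"
  let ?D = "distinct_lists l {s..<n} \<times> distinct_lists l {..<s}"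
  let ?cycle = "\<lambda>(xs, ys). cycle_edges ((!) (splice xs ys)) (2 * l)"
  have "card ?D \<le> 2 * l * card (cycle_copies (2 * l) ?E)"
  proof (rule card_le_mult_card_if_fibres_le[of _ _ ?cycle])
    show "finite ?D" by (simp add: finite_distinct_lists)
    show "finite (cycle_copies (2 * l) ?E)"
      by (rule finite_cycle_copies_simple_graph[OF simple_graph_complete_bipartite])
    show "?cycle ` ?D \<subseteq> cycle_copies (2 * l) ?E"
    proof (rule image_subsetI)
      fix p assume "p \<in> ?D"
      then obtain xs ys where p: "p = (xs, ys)" and xs: "length xs = l" "distinct xs" "set xs \<subseteq> {s..<n}"
        and ys: "length ys = l" "distinct ys" "set ys \<subseteq> {..<s}" by (auto simp: distinct_lists_def)
      have edge: "{xs ! i, ys ! j} \<in> ?E" if "i < l" "j < l" for i j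
        using that xs ys nth_mem[of i xs] nth_mem[of j ys] by (fastforce simp: in_complete_bipartite_iff)
      have "set xs \<inter> set ys = {}" using xs(3) ys(3) by fastforce
      then have "cycle_edges ((!) (splice xs ys)) (2 * l) \<in> cycle_copies (2 * l) ?E"
        using xs ys edge by (intro splice_in_cycle_copies) (auto simp: insert_commute[of "ys ! _"])
      then show "?cycle p \<in> cycle_copies (2 * l) ?E" by (simp add: p)
    qed
    show "card {p \<in> ?D. ?cycle p = C} \<le> 2 * l" for C
      using assms(1) by (intro card_splices_of_cycle_le) auto
  qed
  then show ?thesis
    using assms by (simp add: card_cartesian_product distinct_lists_def card_lists_distinct_length_eq)
qed

lemma prod_atLeastAtMost_eq_falling:
  assumes "l \<le> N"
  shows "real (\<Prod>{N - l + 1..N}) = (\<Prod>i<l. real N - real i)"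
proof -
  have "(\<Prod>i<l. real N - real i) = (\<Prod>j\<in>{N - l + 1..N}. real j)"
    using assms by (intro prod.reindex_bij_witness[of _ "\<lambda>j. N - j" "\<lambda>i. N - i"]) auto
  then show ?thesis by simp
qed

lemma eventually_shifted_power_ge:
  fixes \<epsilon> c :: real
  assumes "\<epsilon> > 0"
  shows "\<forall>\<^sub>F n in sequentially. (1 - \<epsilon>) * real n ^ l \<le> (real n - c) ^ l"
proof -
  have "(\<lambda>n. (1 - c * (1 / real n)) ^ l) \<longlonglongrightarrow> (1 - c * 0) ^ l"
    by (intro tendsto_intros lim_1_over_n)
  then have "(\<lambda>n. (1 - c * (1 / real n)) ^ l) \<longlonglongrightarrow> 1" by simp
  then have "\<forall>\<^sub>F n in sequentially. 1 - \<epsilon> < (1 - c * (1 / real n)) ^ l"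
    using assms by (intro order_tendstoD) auto
  then show ?thesis using eventually_gt_at_top[of 0]
  proof eventually_elim
    case (elim n)
    have "(1 - \<epsilon>) * real n ^ l \<le> (1 - c * (1 / real n)) ^ l * real n ^ l"
      using elim by (intro mult_right_mono) auto
    also have "\<dots> = ((1 - c * (1 / real n)) * real n) ^ l" by (simp add: power_mult_distrib)
    also have "(1 - c * (1 / real n)) * real n = real n - c" using elim by (simp add: field_simps)
    finally show ?case .
  qed
qed

theorem eventually_ex_cyc_ge_if_less:
  fixes \<epsilon> :: real
  assumes l: "2 \<le> l" "l < k" and "\<epsilon> > 0"
  shows "\<forall>\<^sub>F n in sequentially.
    (1 - \<epsilon>) * ((\<Prod>i<l. real (k - 1) - real i) / (2 * real l)) * real n ^ l \<le> real (ex_cyc n l k)"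
proof -
  let ?P = "\<Prod>i<l. real (k - 1) - real i"
  have P_nonneg: "0 \<le> ?P" using l by (intro prod_nonneg) auto
  have "\<forall>\<^sub>F n in sequentially. (1 - \<epsilon>) * real n ^ l \<le> (real n - real (k + l)) ^ l"
    by (rule eventually_shifted_power_ge[OF assms(3)])
  then show ?thesis using eventually_ge_at_top[of "k + l"]
  proof eventually_elim
    case (elim n)
    let ?N = "n - (k - 1)" and ?copies = "cycle_copies (2 * l) (complete_bipartite (k - 1) n)"
    have "(real n - real (k + l)) ^ l = (\<Prod>i<l. real n - real (k + l))" by simp
    also have "\<dots> \<le> (\<Prod>i<l. real ?N - real i)"
      using elim l by (intro prod_mono) auto
    finally have "(1 - \<epsilon>) * real n ^ l * ?P \<le> (\<Prod>i<l. real ?N - real i) * ?P"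
      using elim(1) P_nonneg by (intro mult_right_mono) linarith+
    also have "\<dots> = real (\<Prod>{?N - l + 1..?N} * \<Prod>{k - 1 - l + 1..k - 1})"
      using l elim(2) by (subst (1 2) prod_atLeastAtMost_eq_falling[symmetric]) simp_all
    also have "\<dots> \<le> real (2 * l * card ?copies)"
      unfolding of_nat_le_iff using l elim(2) by (intro card_cycle_copies_complete_bipartite_ge) auto
    also have "\<dots> \<le> real (2 * l * ex_cyc n l k)"
      unfolding of_nat_le_iff using l
      by (intro mult_le_mono2 card_cycle_copies_le_ex_cyc simple_graph_complete_bipartite
          cycle_copies_complete_bipartite_empty) auto
    finally show ?case using l by (simp add: field_simps)
  qed
qed

subsection \<open>Blown-up cycles\<close>

definition blown_cycle :: "nat \<Rightarrow> nat \<Rightarrow> nat set set" where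
  "blown_cycle l n = (\<lambda>v. {v, v mod l}) ` {l..<n} \<union> (\<lambda>v. {v, Suc v mod l}) ` {l..<n}"

lemma in_blown_cycleD:
  assumes "{x, y} \<in> blown_cycle l n" "x < l"
  shows "x = y mod l \<or> x = Suc y mod l"
  using assms by (auto simp: blown_cycle_def doubleton_eq_iff)

lemma blown_cycle_bipartite:
  assumes "{x, y} \<in> blown_cycle l n" "l > 0"
  shows "x < l \<longleftrightarrow> \<not> y < l"
proof -
  have "v mod l < l" for v using assms(2) by simp
  then show ?thesis using assms(1) by (auto simp: blown_cycle_def doubleton_eq_iff)
qed

lemma simple_graph_blown_cycle:
  assumes "l > 0"
  shows "simple_graph n (blown_cycle l n)"
proof -
  have "\<exists>u w. {v, t mod l} = {u, w} \<and> u \<noteq> w \<and> u < n \<and> w < n" if "l \<le> v" "v < n" for v t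
  proof -
    have "t mod l < l" using assms by simp
    then show ?thesis using that by (intro exI[of _ v] exI[of _ "t mod l"]) auto
  qed
  then show ?thesis by (auto simp: simple_graph_def blown_cycle_def)
qed

lemma two_steps_in_blown_cycle:
  assumes edges: "{x, v} \<in> blown_cycle l n" "{y, v} \<in> blown_cycle l n" and "x < l" "y < l" "x \<noteq> y"
  shows "\<exists>s\<in>{1, -1}. int l dvd int y - (int x + s)"
proof -
  have forward: "int l dvd int (Suc v mod l) - (int (v mod l) + 1)"
    by (simp add: zmod_int mod_simps flip: mod_eq_dvd_iff) (simp add: add.commute)
  then have backward: "int l dvd int (v mod l) - (int (Suc v mod l) + - 1)"
    by (simp add: dvd_diff_commute algebra_simps)
  have "x = v mod l \<and> y = Suc v mod l \<or> x = Suc v mod l \<and> y = v mod l"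
    using in_blown_cycleD[OF edges(1) assms(3)] in_blown_cycleD[OF edges(2) assms(4)] assms(5) by auto
  then show ?thesis using forward backward by blast
qed

lemma nonbacktracking_walk_mod:
  fixes q :: int and u :: "nat \<Rightarrow> int"
  assumes step: "\<And>i. \<exists>s\<in>{1, -1}. q dvd u (Suc i) - (u i + s)"
    and nonbacktracking: "\<And>i. \<not> q dvd u (i + 2) - u i"
  shows "\<exists>s\<in>{1, -1}. \<forall>i. q dvd u i - (u 0 + s * int i)"
proof -
  obtain s where s: "s \<in> {1, -1}" "q dvd u 1 - (u 0 + s)"
    using step[of 0] unfolding One_nat_def by blast
  have same_direction: "q dvd u (Suc i) - (u i + s)" for i
  proof (induction i)
    case (Suc i)
    obtain s' where s': "s' \<in> {1, -1}" "q dvd u (Suc (Suc i)) - (u (Suc i) + s')" using step by blast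
    have "s' = s"
    proof (rule ccontr)
      assume "s' \<noteq> s"
      then have "s' = - s" using s(1) s'(1) by auto
      then have "q dvd u (i + 2) - u i" using dvd_add[OF Suc s'(2)] by simp
      then show False using nonbacktracking by blast
    qed
    then show ?case using s'(2) by simp
  qed (use s(2) in simp)
  have "q dvd u i - (u 0 + s * int i)" for i
  proof (induction i)
    case (Suc i)
    then show ?case using dvd_add[OF Suc same_direction[of i]] by (simp add: algebra_simps)
  qed simp
  then show ?thesis using s(1) by blast
qed

text \<open>The small vertices of a cycle walk around Z/l by steps 1 and -1; as they are distinct, the
  direction never changes, so the walk must close up after a multiple of \<open>l\<close> steps.\<close>

lemma cycle_copies_blown_cycle_empty:
  assumes "3 \<le> k" "k < l"
  shows "cycle_copies (2 * k) (blown_cycle l n) = {}"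
proof (rule ccontr)
  have l_pos: "l > 0" using assms by simp
  assume "cycle_copies (2 * k) (blown_cycle l n) \<noteq> {}"
  then have "\<exists>g\<in>cycle_params (2 * k) (blown_cycle l n). \<forall>i. g (2 * int i) < l"
    using l_pos assms(1) by (intro ex_bipartite_cycle_param blown_cycle_bipartite) auto
  then obtain g where g: "g \<in> cycle_params (2 * k) (blown_cycle l n)" and small: "\<And>i. g (2 * int i) < l"
    by blast
  define u where "u i = int (g (2 * int i))" for i
  have cyclic: "cyclic (2 * k) g" by (rule cycle_params_cyclic[OF g])
  have u_dvd_iff: "int l dvd u i - u j \<longleftrightarrow> int (2 * k) dvd 2 * int i - 2 * int j" for i j
  proof -
    have "int l dvd u i - u j \<longleftrightarrow> g (2 * int i) = g (2 * int j)"
      using small[of i] small[of j] by (simp add: u_def flip: mod_eq_dvd_iff)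
    then show ?thesis by (simp only: cyclic_eq_iff[OF cyclic])
  qed
  have no_return: "\<not> int l dvd u (i + d) - u i" if "0 < d" "d < k" for i d
    using that by (auto simp: u_dvd_iff algebra_simps dest: zdvd_imp_le)
  have "\<exists>s\<in>{1, -1}. int l dvd u (Suc i) - (u i + s)" for i
    unfolding u_def
  proof (rule two_steps_in_blown_cycle[OF _ _ small small])
    show "{g (2 * int i), g (2 * int i + 1)} \<in> blown_cycle l n"
      by (rule cycle_params_edge[OF g])
    show "{g (2 * int (Suc i)), g (2 * int i + 1)} \<in> blown_cycle l n"
      using cycle_params_edge[OF g, of "2 * int i + 1"] by (simp add: insert_commute algebra_simps)
    show "g (2 * int i) \<noteq> g (2 * int (Suc i))"
      using no_return[of 1 i] assms(1) by (auto simp: u_def)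
  qed
  then have "\<exists>s\<in>{1, -1}. \<forall>i. int l dvd u i - (u 0 + s * int i)"
    using no_return[of 2] assms(1) by (intro nonbacktracking_walk_mod) auto
  then obtain s where "s \<in> {1, -1}" "int l dvd u k - (u 0 + s * int k)" by blast
  moreover have "int l dvd u k - u 0" by (simp add: u_dvd_iff)
  ultimately have "int l dvd int k" using dvd_diff[of "int l" "u k - u 0" "u k - (u 0 + s * int k)"] by auto
  then show False using assms by (auto dest: zdvd_imp_le)
qed

definition blow_up :: "nat \<Rightarrow> nat \<Rightarrow> nat \<Rightarrow> nat set" where
  "blow_up l n i = {v \<in> {l..<n}. v mod l = i}"

lemma card_blow_up_ge:
  assumes "i < l"
  shows "n div l - 1 \<le> card (blow_up l n i)"
proof -
  have "(\<lambda>t. l + i + l * t) ` {..<n div l - 1} \<subseteq> blow_up l n i"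
  proof (rule image_subsetI)
    fix t assume "t \<in> {..<n div l - 1}"
    then have "l * (t + 2) \<le> l * (n div l)" by (intro mult_le_mono2) simp
    also have "\<dots> \<le> n" by simp
    finally show "l + i + l * t \<in> blow_up l n i" using assms by (simp add: blow_up_def)
  qed
  moreover have "inj_on (\<lambda>t. l + i + l * t) {..<n div l - 1}" using assms by (auto simp: inj_on_def)
  moreover have "finite (blow_up l n i)" by (simp add: blow_up_def)
  ultimately have "card {..<n div l - 1} \<le> card (blow_up l n i)" by (intro card_inj_on_le)
  then show ?thesis by simp
qed

definition blown_copy :: "nat \<Rightarrow> (nat \<Rightarrow> nat) \<Rightarrow> nat set set" where
  "blown_copy l b = cycle_edges ((!) (splice [0..<l] (map b [0..<l]))) (2 * l)"

lemma blown_copy_in_cycle_copies: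
  assumes b: "b \<in> (\<Pi>\<^sub>E i\<in>{..<l}. blow_up l n i)"
  shows "blown_copy l b \<in> cycle_copies (2 * l) (blown_cycle l n)"
proof -
  have in_blow_up: "l \<le> b i" "b i < n" "b i mod l = i" if "i < l" for i
    using PiE_mem[OF b, of i] that by (auto simp: blow_up_def)
  show ?thesis
    unfolding blown_copy_def
  proof (rule splice_in_cycle_copies)
    show "distinct (map b [0..<l])"
      unfolding distinct_map by (auto intro!: inj_on_inverseI[of _ "\<lambda>v. v mod l"] simp: in_blow_up)
    show "set [0..<l] \<inter> set (map b [0..<l]) = {}" using in_blow_up(1) by fastforce
    fix i assume i: "i < l"
    show "{[0..<l] ! i, map b [0..<l] ! i} \<in> blown_cycle l n"
      using i in_blow_up[OF i] by (auto simp: blown_cycle_def insert_commute intro!: image_eqI[of _ _ "b i"])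
    have "Suc (b i) mod l = Suc i mod l" using mod_Suc_eq[of "b i" l] in_blow_up(3)[OF i] by simp
    then show "{map b [0..<l] ! i, [0..<l] ! (Suc i mod l)} \<in> blown_cycle l n"
      using i in_blow_up[OF i] by (auto simp: blown_cycle_def intro!: image_eqI[of _ _ "b i"])
  qed simp_all
qed

lemma Union_blown_copy: "\<Union> (blown_copy l b) = {..<l} \<union> b ` {..<l}"
proof -
  have "\<Union> (blown_copy l b) = set (splice [0..<l] (map b [0..<l]))"
    unfolding blown_copy_def Union_cycle_edges lessThan_atLeast0 by (subst nth_image) simp_all
  then show ?thesis by (simp add: set_splice atLeast0LessThan)
qed

lemma inj_on_blown_copy: "inj_on (blown_copy l) (\<Pi>\<^sub>E i\<in>{..<l}. blow_up l n i)"
proof (rule inj_onI)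
  fix b c assume b: "b \<in> (\<Pi>\<^sub>E i\<in>{..<l}. blow_up l n i)" and c: "c \<in> (\<Pi>\<^sub>E i\<in>{..<l}. blow_up l n i)"
    and "blown_copy l b = blown_copy l c"
  then have vertices: "{..<l} \<union> b ` {..<l} = {..<l} \<union> c ` {..<l}" by (metis Union_blown_copy)
  show "b = c"
  proof (rule PiE_ext[OF b c])
    fix i assume i: "i \<in> {..<l}"
    then have bi: "l \<le> b i" "b i mod l = i" using PiE_mem[OF b] by (auto simp: blow_up_def)
    have "b i \<in> {..<l} \<union> c ` {..<l}" using vertices i by blast
    then obtain j where j: "j < l" "b i = c j" using bi(1) by auto
    then have "c j mod l = j" using PiE_mem[OF c, of j] by (auto simp: blow_up_def)
    then show "b i = c i" using bi(2) j(2) by simp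
  qed
qed

lemma card_cycle_copies_blown_cycle_ge:
  assumes "l > 0"
  shows "(n div l - 1) ^ l \<le> card (cycle_copies (2 * l) (blown_cycle l n))"
proof -
  have "(n div l - 1) ^ l = (\<Prod>i<l. n div l - 1)" by simp
  also have "\<dots> \<le> (\<Prod>i<l. card (blow_up l n i))"
    using card_blow_up_ge by (intro prod_mono) auto
  also have "\<dots> = card (\<Pi>\<^sub>E i\<in>{..<l}. blow_up l n i)" by (simp add: card_PiE)
  also have "\<dots> \<le> card (cycle_copies (2 * l) (blown_cycle l n))"
  proof (rule card_inj_on_le[OF inj_on_blown_copy])
    show "blown_copy l ` (\<Pi>\<^sub>E i\<in>{..<l}. blow_up l n i) \<subseteq> cycle_copies (2 * l) (blown_cycle l n)"
      using blown_copy_in_cycle_copies by blast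
    show "finite (cycle_copies (2 * l) (blown_cycle l n))"
      by (rule finite_cycle_copies_simple_graph[OF simple_graph_blown_cycle[OF assms]])
  qed
  finally show ?thesis .
qed

lemma diff_le_mult_div_minus_one:
  assumes "l > 0"
  shows "real n - 2 * real l \<le> real l * real (n div l - 1)"
proof -
  have "n \<le> l * (n div l) + l"
    using mult_div_mod_eq[of l n] mod_less_divisor[OF assms, of n] by linarith
  also have "\<dots> \<le> l * (n div l - 1) + 2 * l" by (cases "n div l") auto
  finally have "real n \<le> real (l * (n div l - 1) + 2 * l)" by (simp only: of_nat_le_iff)
  then show ?thesis by simp
qed

theorem eventually_ex_cyc_ge_if_greater:
  fixes \<epsilon> :: real
  assumes kl: "3 \<le> k" "k < l" and "\<epsilon> > 0"
  shows "\<forall>\<^sub>F n in sequentially. (1 - \<epsilon>) * (1 / real l ^ l) * real n ^ l \<le> real (ex_cyc n l k)"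
proof -
  have l_pos: "l > 0" using kl by simp
  have "\<forall>\<^sub>F n in sequentially. (1 - \<epsilon>) * real n ^ l \<le> (real n - 2 * real l) ^ l"
    by (rule eventually_shifted_power_ge[OF assms(3)])
  then show ?thesis using eventually_ge_at_top[of "2 * l"]
  proof eventually_elim
    case (elim n)
    note elim(1)
    also have "(real n - 2 * real l) ^ l \<le> (real l * real (n div l - 1)) ^ l"
      using elim(2) by (intro power_mono diff_le_mult_div_minus_one l_pos) simp
    also have "\<dots> = real l ^ l * real ((n div l - 1) ^ l)" by (simp add: power_mult_distrib)
    also have "\<dots> \<le> real l ^ l * real (ex_cyc n l k)"
    proof (intro mult_left_mono of_nat_mono)
      show "(n div l - 1) ^ l \<le> ex_cyc n l k"
        using card_cycle_copies_blown_cycle_ge[OF l_pos] card_cycle_copies_le_ex_cyc[OF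
          simple_graph_blown_cycle[OF l_pos] cycle_copies_blown_cycle_empty[OF kl]]
        by (rule order_trans)
    qed simp
    finally show ?case using l_pos by (simp add: field_simps)
  qed
qed

lemma upper_coeff_le:
  fixes \<epsilon> :: real
  assumes "3 \<le> l" "0 \<le> \<epsilon>"
  shows "real (k - 1) ^ l / real l \<le> (1 + \<epsilon>) * (2 ^ (l - 2) * real (k - 1) ^ l / (2 * real l))"
proof -
  have "(2 :: real) ^ 1 \<le> 2 ^ (l - 2)" using assms(1) by (intro power_increasing) auto
  then have "1 * 2 \<le> (1 + \<epsilon>) * 2 ^ (l - 2)" using assms(2) by (intro mult_mono) auto
  then have "2 * (real (k - 1) ^ l / (2 * real l)) \<le> (1 + \<epsilon>) * 2 ^ (l - 2) * (real (k - 1) ^ l / (2 * real l))"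
    by (intro mult_right_mono) auto
  then show ?thesis by (simp add: mult_ac)
qed

theorem theorem8:
  fixes k l :: nat
  shows "(3 \<le> l \<and> 2 \<le> k \<longrightarrow>
           (\<forall>\<epsilon>>0. \<forall>\<^sub>F n in sequentially.
              real (ex_cyc n l k) \<le> (1 + \<epsilon>) * (2 ^ (l - 2) * real (k - 1) ^ l / (2 * real l)) * real n ^ l))
       \<and> (l \<ge> 2 \<and> k > l \<longrightarrow>
           (\<forall>\<epsilon>>0. \<forall>\<^sub>F n in sequentially.
              real (ex_cyc n l k) \<ge> (1 - \<epsilon>) * ((\<Prod>i<l. real (k - 1) - real i) / (2 * real l)) * real n ^ l))
       \<and> (k \<ge> 3 \<and> l > k \<longrightarrow>
           (\<forall>\<epsilon>>0. \<forall>\<^sub>F n in sequentially.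
              real (ex_cyc n l k) \<ge> (1 - \<epsilon>) * (1 / real l ^ l) * real n ^ l))"
proof (intro conjI impI allI)
  fix \<epsilon> :: real
  assume kl: "3 \<le> l \<and> 2 \<le> k" and "\<epsilon> > 0"
  then have coeff: "real (k - 1) ^ l / real l \<le> (1 + \<epsilon>) * (2 ^ (l - 2) * real (k - 1) ^ l / (2 * real l))"
    by (intro upper_coeff_le) auto
  have "\<forall>\<^sub>F n in sequentially. real (ex_cyc n l k) \<le> real (k - 1) ^ l / real l * real n ^ l"
    using kl by (intro eventually_ex_cyc_le) auto
  then show "\<forall>\<^sub>F n in sequentially.
    real (ex_cyc n l k) \<le> (1 + \<epsilon>) * (2 ^ (l - 2) * real (k - 1) ^ l / (2 * real l)) * real n ^ l"
    by eventually_elim (rule order_trans[OF _ mult_right_mono[OF coeff]], simp_all)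
next
  fix \<epsilon> :: real
  assume "l \<ge> 2 \<and> k > l" and "\<epsilon> > 0"
  then show "\<forall>\<^sub>F n in sequentially.
    real (ex_cyc n l k) \<ge> (1 - \<epsilon>) * ((\<Prod>i<l. real (k - 1) - real i) / (2 * real l)) * real n ^ l"
    by (intro eventually_ex_cyc_ge_if_less) auto
next
  fix \<epsilon> :: real
  assume "k \<ge> 3 \<and> l > k" and "\<epsilon> > 0"
  then show "\<forall>\<^sub>F n in sequentially. real (ex_cyc n l k) \<ge> (1 - \<epsilon>) * (1 / real l ^ l) * real n ^ l"
    by (intro eventually_ex_cyc_ge_if_greater) auto
qed

end
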